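(* Let $k\ge 1$ and let $\Phi$ (fine-grid time-stepping operator) and $\Psi$ (coarse-grid time-stepping operator) be time-independent $n\times n$ matrices that are stable ($\|\Phi^p\|<1$ and $\|\Psi^p\|<1$ for some $p$). Assume that $\Phi$ and $\Psi$ are simultaneously diagonalizable, with common eigenvectors forming the columns of $U$ and eigenvalues $\{\lambda_i\}_i$ and $\{\mu_i\}_i$, respectively. Let $\mathcal{E}_F,\mathcal{E}_{FCF}$ and $\mathcal{R}_F,\mathcal{R}_{FCF}$ be the error- and residual-propagation operators of two-level MGRIT with $N_c$ coarse-grid time points, coarsening factor $k$, and F-, respectively FCF-relaxation, as defined in the context. Let $\widetilde{U}$ be the block-diagonal matrix with every diagonal block equal to $U$ (one block per time point). Then $$\|\mathcal{R}_F\|_{(\widetilde{U}\widetilde{U}^* )^{-1}}=\|\mathcal{E}_F\|_{(\widetilde{U}\widetilde{U}^* )^{-1}}=\max_i\sqrt{\frac{1-|\lambda_i|^{2k}}{1-|\lambda_i|^2}}\;\frac{|\mu_i-\lambda_i^k|}{(1-|\mu_i|)+O(1/N_c)},$$ $$\|\mathcal{R}_{FCF}\|_{(\widetilde{U}\widetilde{U}^* )^{-1}}=\|\mathcal{E}_{FCF}\|_{(\widetilde{U}\widetilde{U}^* )^{-1}}=\max_i\sqrt{\frac{1-|\lambda_i|^{2k}}{1-|\lambda_i|^2}}\;\frac{|\lambda_i|^k\,|\mu_i-\lambda_i^k|}{(1-|\mu_i|)+O(1/N_c)}.$$ Here each $O(1/N_c)$ denotes a real quantity, depending on $i$ and $N_c$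 (and on which of the two lines is considered), that is bounded by a constant times $1/N_c$ as $N_c\to\infty$ with $\Phi,\Psi,k$ fixed.
   Context: $\|\cdot\|$ is the $\ell^2$ norm. For an invertible $\widetilde U$, the $(\widetilde{U}\widetilde{U}^* )^{-1}$-norm of a vector is $\|\mathbf{v}\|_{(\widetilde{U}\widetilde{U}^* )^{-1}}=\langle(\widetilde{U}\widetilde{U}^* )^{-1}\mathbf{v},\mathbf{v}\rangle^{1/2}=\|\widetilde{U}^{-1}\mathbf{v}\|$, and the norm of an operator is the induced operator norm. Two-level MGRIT. Take $N=(N_c-1)k+1$ time points $0,1,\dots,N-1$ and let $A$ be the $N\times N$ block lower bidiagonal space-time matrix with $n\times n$ identity blocks on the diagonal, $-\Phi$ in every block of the first subdiagonal, and zero elsewhere. Time points $0,k,2k,\dots,(N_c-1)k$ are C-points; all others are F-points. After reordering with F-points first, $A$ is partitioned as $\begin{bmatrix} A_{ff} & A_{fc} \\ A_{cf} & A_{cc} \end{bmatrix}$. Let $A_\Delta$ (the Schur complement of $A$ on C-points) and $B_\Delta$ be the $N_c\times N_c$ block lower bidiagonal matrices with identity diagonal blocks and with every first-subdiagonal block equal to $-\Phi^k$, respectively $-\Psi$. The error- and residual-propagation operators of one iteration are $$\mathcal{E}_F=\begin{bmatrix}-A_{ff}^{-1}A_{fc} \\ I\end{bmatrix}\begin{bmatrix}\mathbf{0}& I-B_\Delta^{-1}A_\Delta\end{bmatrix},\qquad \mathcal{E}_{FCF}=\begin{bmatrix}-A_{ff}^{-1}A_{fc} \\ I\end{bmatrix}\begin{bmatrix}\mathbf{0}&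 (I-B_\Delta^{-1}A_\Delta)(I-A_\Delta)\end{bmatrix},$$ $$\mathcal{R}_F=\begin{bmatrix}\mathbf{0} \\ I-A_\Delta B_\Delta^{-1}\end{bmatrix}\begin{bmatrix}-A_{cf}A_{ff}^{-1}&I\end{bmatrix},\qquad \mathcal{R}_{FCF}=\begin{bmatrix}\mathbf{0} \\ (I-A_\Delta B_\Delta^{-1})(I-A_\Delta)\end{bmatrix}\begin{bmatrix}-A_{cf}A_{ff}^{-1}&I\end{bmatrix}.$$ *)

theory Defs
  imports
    "Jordan_Normal_Form.Schur_Decomposition"
    "Jordan_Normal_Form.DL_Submatrix"
    "HOL-Library.Landau_Symbols"
begin

text \<open>Norms. \<open>vnorm_wrt W v\<close> is \<open>\<langle>W v, v\<rangle>\<^sup>1\<^sup>/\<^sup>2\<close> and is meant for Hermitian positive definite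
  \<open>W\<close>, where the inner product is real. \<open>opnorm_wrt W\<close> is meant for \<open>W\<close> and \<open>M\<close> square of the
  same nonzero dimension.\<close>

definition vnorm_wrt :: "complex mat \<Rightarrow> complex vec \<Rightarrow> real" where
  "vnorm_wrt W v = sqrt (Re ((W *\<^sub>v v) \<bullet>c v))"

definition opnorm_wrt :: "complex mat \<Rightarrow> complex mat \<Rightarrow> real" where
  "opnorm_wrt W M =
     Sup {vnorm_wrt W (M *\<^sub>v v) / vnorm_wrt W v | v.
            v \<in> carrier_vec (dim_col M) \<and> v \<noteq> 0\<^sub>v (dim_col M)}"

definition l2_opnorm :: "complex mat \<Rightarrow> real" where
  "l2_opnorm M = opnorm_wrt (1\<^sub>m (dim_row M)) M"

definition stable_mat :: "complex mat \<Rightarrow> bool" where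
  "stable_mat X \<longleftrightarrow> (\<exists>p. l2_opnorm (X ^\<^sub>m p) < 1)"

text \<open>The inverse of an invertible matrix; unspecified for singular matrices.\<close>

definition mat_inv :: "complex mat \<Rightarrow> complex mat" where
  "mat_inv A = the (mat_inverse A)"

definition append_cols :: "complex mat \<Rightarrow> complex mat \<Rightarrow> complex mat" (infixr \<open>@\<^sub>c\<close> 65) where
  "A @\<^sub>c B = four_block_mat A B (0\<^sub>m 0 (dim_col A)) (0\<^sub>m 0 (dim_col B))"

text \<open>\<open>block_bidiag n m X\<close> has \<open>m \<times> m\<close> blocks of size \<open>n \<times> n\<close>; scalar index \<open>r\<close> is
  component \<open>r mod n\<close> at time point \<open>r div n\<close>.\<close>

definition block_bidiag :: "nat \<Rightarrow> nat \<Rightarrow> complex mat \<Rightarrow> complex mat" where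
  "block_bidiag n m X = mat (m * n) (m * n) (\<lambda>(r, c).
     if r div n = c div n then 1\<^sub>m n $$ (r mod n, c mod n)
     else if r div n = Suc (c div n) then (- X) $$ (r mod n, c mod n)
     else 0)"

definition num_points :: "nat \<Rightarrow> nat \<Rightarrow> nat" where
  "num_points k Nc = (Nc - 1) * k + 1"

definition spacetime_mat :: "nat \<Rightarrow> nat \<Rightarrow> nat \<Rightarrow> complex mat \<Rightarrow> complex mat" where
  "spacetime_mat n k Nc \<Phi> = block_bidiag n (num_points k Nc) \<Phi>"

definition C_idx :: "nat \<Rightarrow> nat \<Rightarrow> nat set" where
  "C_idx n k = {r. k dvd r div n}"

definition F_idx :: "nat \<Rightarrow> nat \<Rightarrow> nat set" where
  "F_idx n k = {r. \<not> k dvd r div n}"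

definition A_ff :: "nat \<Rightarrow> nat \<Rightarrow> nat \<Rightarrow> complex mat \<Rightarrow> complex mat" where
  "A_ff n k Nc \<Phi> = submatrix (spacetime_mat n k Nc \<Phi>) (F_idx n k) (F_idx n k)"

definition A_fc :: "nat \<Rightarrow> nat \<Rightarrow> nat \<Rightarrow> complex mat \<Rightarrow> complex mat" where
  "A_fc n k Nc \<Phi> = submatrix (spacetime_mat n k Nc \<Phi>) (F_idx n k) (C_idx n k)"

definition A_cf :: "nat \<Rightarrow> nat \<Rightarrow> nat \<Rightarrow> complex mat \<Rightarrow> complex mat" where
  "A_cf n k Nc \<Phi> = submatrix (spacetime_mat n k Nc \<Phi>) (C_idx n k) (F_idx n k)"

definition A_Delta :: "nat \<Rightarrow> nat \<Rightarrow> nat \<Rightarrow> complex mat \<Rightarrow> complex mat" where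
  "A_Delta n k Nc \<Phi> = block_bidiag n Nc (\<Phi> ^\<^sub>m k)"

definition B_Delta :: "nat \<Rightarrow> nat \<Rightarrow> complex mat \<Rightarrow> complex mat" where
  "B_Delta n Nc \<Psi> = block_bidiag n Nc \<Psi>"

text \<open>Rows and columns of the following operators are ordered with F-points first.\<close>

definition interp_op :: "nat \<Rightarrow> nat \<Rightarrow> nat \<Rightarrow> complex mat \<Rightarrow> complex mat" where
  "interp_op n k Nc \<Phi> =
     (- (mat_inv (A_ff n k Nc \<Phi>) * A_fc n k Nc \<Phi>)) @\<^sub>r 1\<^sub>m (Nc * n)"

definition restr_op :: "nat \<Rightarrow> nat \<Rightarrow> nat \<Rightarrow> complex mat \<Rightarrow> complex mat" where
  "restr_op n k Nc \<Phi> =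
     (- (A_cf n k Nc \<Phi> * mat_inv (A_ff n k Nc \<Phi>))) @\<^sub>c 1\<^sub>m (Nc * n)"

definition num_F :: "nat \<Rightarrow> nat \<Rightarrow> nat \<Rightarrow> nat" where
  "num_F n k Nc = (num_points k Nc - Nc) * n"

definition err_F :: "nat \<Rightarrow> nat \<Rightarrow> nat \<Rightarrow> complex mat \<Rightarrow> complex mat \<Rightarrow> complex mat" where
  "err_F n k Nc \<Phi> \<Psi> =
     (let A = A_Delta n k Nc \<Phi>; B = B_Delta n Nc \<Psi>; I = 1\<^sub>m (Nc * n) in
      interp_op n k Nc \<Phi> *
        (0\<^sub>m (Nc * n) (num_F n k Nc) @\<^sub>c (I - mat_inv B * A)))"

definition err_FCF :: "nat \<Rightarrow> nat \<Rightarrow> nat \<Rightarrow> complex mat \<Rightarrow> complex mat \<Rightarrow> complex mat" where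
  "err_FCF n k Nc \<Phi> \<Psi> =
     (let A = A_Delta n k Nc \<Phi>; B = B_Delta n Nc \<Psi>; I = 1\<^sub>m (Nc * n) in
      interp_op n k Nc \<Phi> *
        (0\<^sub>m (Nc * n) (num_F n k Nc) @\<^sub>c ((I - mat_inv B * A) * (I - A))))"

definition res_F :: "nat \<Rightarrow> nat \<Rightarrow> nat \<Rightarrow> complex mat \<Rightarrow> complex mat \<Rightarrow> complex mat" where
  "res_F n k Nc \<Phi> \<Psi> =
     (let A = A_Delta n k Nc \<Phi>; B = B_Delta n Nc \<Psi>; I = 1\<^sub>m (Nc * n) in
      (0\<^sub>m (num_F n k Nc) (Nc * n) @\<^sub>r (I - A * mat_inv B)) *
        restr_op n k Nc \<Phi>)"

definition res_FCF :: "nat \<Rightarrow> nat \<Rightarrow> nat \<Rightarrow> complex mat \<Rightarrow> complex mat \<Rightarrow> complex mat" where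
  "res_FCF n k Nc \<Phi> \<Psi> =
     (let A = A_Delta n k Nc \<Phi>; B = B_Delta n Nc \<Psi>; I = 1\<^sub>m (Nc * n) in
      (0\<^sub>m (num_F n k Nc) (Nc * n) @\<^sub>r ((I - A * mat_inv B) * (I - A))) *
        restr_op n k Nc \<Phi>)"

definition U_tilde :: "nat \<Rightarrow> nat \<Rightarrow> complex mat \<Rightarrow> complex mat" where
  "U_tilde k Nc U = diag_block_mat (replicate (num_points k Nc) U)"

definition UU_opnorm :: "nat \<Rightarrow> nat \<Rightarrow> complex mat \<Rightarrow> complex mat \<Rightarrow> real" where
  "UU_opnorm k Nc U M =
     opnorm_wrt (mat_inv (U_tilde k Nc U * mat_adjoint (U_tilde k Nc U))) M"

end

theory Submission
  imports Defs "HOL-Analysis.L2_Norm"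
begin

text \<open>In the common eigenbasis every operator decouples into one scalar problem per eigenvector, so
  each norm is the maximum over \<open>i\<close> of the norm of a scalar matrix built from \<open>\<lambda>\<^sub>i\<close> and \<open>\<mu>\<^sub>i\<close>.
  Reversing time and transposing exchanges the scalar error and residual propagators, hence their
  norms agree. The coarse-grid part is \<open>\<mu>\<^sub>i - \<lambda>\<^sub>i\<^sup>k\<close> times a shift of the lower triangular Toeplitz
  matrix \<open>T\<close> with entries \<open>\<mu>\<^sub>i\<^sup>j\<close>; interpolation multiplies the contribution of every coarse point but the last by
  \<open>\<Sum>m<k. \<bar>\<lambda>\<^sub>i\<bar>\<^sup>2\<^sup>m\<close> in the squared norm. The matrix \<open>T\<close> satisfies \<open>T x = x + \<mu>\<^sub>i S (T x)\<close> with a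
  shift \<open>S\<close>, so its norm is at most \<open>1 / (1 - \<bar>\<mu>\<^sub>i\<bar>)\<close>, and the vector of powers of the phase of \<open>\<mu>\<^sub>i\<close>
  shows that this bound is attained up to a relative error \<open>O(1 / N\<^sub>c)\<close>.\<close>

subsection \<open>Operator norms of finite complex arrays\<close>

text \<open>The weight makes the columns of \<open>U\<close> orthonormal although \<open>U\<close>
  need not be unitary. This is why the operator norm is an exact maximum over eigenvectors and not
  an estimate with the condition number of \<open>U\<close>. The scalar norms themselves are only
  estimated, so the error term is chosen as whatever makes the rate formula an equality, and only
  its size remains to be bounded. Solving for it requires a nonzero scalar norm, that is, more
  coarse points than the order \<open>d\<close> of the shift (1 for F-, 2 for FCF-relaxation). The
  upper bound on the norm makes the error term nonnegative; the test vector bounds it from above.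
  What the test vector loses stays bounded while its squared norm is \<open>N\<^sub>c\<close>: the
  first \<open>d\<close> rows vanish, the last coarse point lacks interpolation weight, and the
  geometric sums need some rows to approach their limit.\<close>

lemma sum_div_mod:
  fixes f :: "nat \<Rightarrow> nat \<Rightarrow> 'a::comm_monoid_add"
  shows "(\<Sum>r<p * n. f (r div n) (r mod n)) = (\<Sum>t<p. \<Sum>b<n. f t b)"
proof (induction p)
  case (Suc p)
  have "(\<Sum>r<Suc p * n. f (r div n) (r mod n)) =
      (\<Sum>r<p * n. f (r div n) (r mod n)) + (\<Sum>r=p * n..<p * n + n. f (r div n) (r mod n))"
    by (subst sum.union_disjoint[symmetric]) (auto intro: sum.cong)
  also have "(\<Sum>r=p * n..<p * n + n. f (r div n) (r mod n)) = (\<Sum>b<n. f p b)"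
    using sum.shift_bounds_nat_ivl[of "\<lambda>r. f (r div n) (r mod n)" 0 "p * n" n]
    by (auto simp: add.commute atLeast0LessThan intro!: sum.cong)
  finally show ?case using Suc by simp
qed simp

text \<open>Vectors and arrays are total functions with explicit sizes, so that shifting,
  transposing and permuting indices need no carrier conditions.\<close>

definition l2norm :: "nat \<Rightarrow> (nat \<Rightarrow> complex) \<Rightarrow> real" where
  "l2norm p x = L2_set (\<lambda>t. cmod (x t)) {..<p}"

definition arr_apply :: "nat \<Rightarrow> (nat \<Rightarrow> nat \<Rightarrow> complex) \<Rightarrow> (nat \<Rightarrow> complex) \<Rightarrow> nat \<Rightarrow> complex" where
  "arr_apply q m x t = (\<Sum>s<q. m t s * x s)"

text \<open>The supremum over the unit ball is never over an empty set, since the ball contains 0,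
  and it involves no division.\<close>

definition arr_norm :: "nat \<Rightarrow> nat \<Rightarrow> (nat \<Rightarrow> nat \<Rightarrow> complex) \<Rightarrow> real" where
  "arr_norm p q m = (SUP x\<in>{x. l2norm q x \<le> 1}. l2norm p (arr_apply q m x))"

lemma l2norm_power2: "(l2norm p x)\<^sup>2 = (\<Sum>t<p. (cmod (x t))\<^sup>2)"
  by (simp add: l2norm_def L2_set_def sum_nonneg)

lemma l2norm_nonneg [simp]: "0 \<le> l2norm p x"
  by (simp add: l2norm_def)

lemma l2norm_cong: "(\<And>t. t < p \<Longrightarrow> x t = y t) \<Longrightarrow> l2norm p x = l2norm p y"
  unfolding l2norm_def by (intro L2_set_cong) auto

lemma l2norm_0 [simp]: "l2norm p (\<lambda>_. 0) = 0"
  by (simp add: l2norm_def L2_set_def)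

lemma l2norm_eq_0_iff: "l2norm p x = 0 \<longleftrightarrow> (\<forall>t<p. x t = 0)"
  by (auto simp: l2norm_def L2_set_eq_0_iff)

lemma l2norm_scale: "l2norm p (\<lambda>t. c * x t) = cmod c * l2norm p x"
  unfolding l2norm_def by (simp add: norm_mult L2_set_right_distrib)

lemma l2norm_triangle: "l2norm p (\<lambda>t. x t + y t) \<le> l2norm p x + l2norm p y"
  unfolding l2norm_def
  by (rule order_trans[OF _ L2_set_triangle_ineq]) (intro L2_set_mono norm_triangle_ineq norm_ge_zero)

lemma l2norm_cnj: "l2norm p (\<lambda>t. cnj (x t)) = l2norm p x"
  by (simp add: l2norm_def)

lemma l2norm_ge: "t < p \<Longrightarrow> cmod (x t) \<le> l2norm p x"
  unfolding l2norm_def by (rule member_le_L2_set[of _ t "\<lambda>t. cmod (x t)"]) auto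

lemma l2norm_Cauchy_Schwarz: "cmod (\<Sum>t<p. x t * y t) \<le> l2norm p x * l2norm p y"
proof -
  have "cmod (\<Sum>t<p. x t * y t) \<le> (\<Sum>t<p. \<bar>cmod (x t)\<bar> * \<bar>cmod (y t)\<bar>)"
    by (rule sum_norm_le) (simp add: norm_mult)
  also have "\<dots> \<le> l2norm p x * l2norm p y"
    unfolding l2norm_def by (rule L2_set_mult_ineq)
  finally show ?thesis .
qed

text \<open>Truncation to \<open>p\<close> entries only drops squares, so every shift is a
  contraction.\<close>

lemma l2norm_shift: "l2norm p (\<lambda>t. if t < d then 0 else x (t - d)) \<le> l2norm p x"
proof -
  have "(\<Sum>t<p. (cmod (if t < d then 0 else x (t - d)))\<^sup>2) = (\<Sum>t=d..<p. (cmod (x (t - d)))\<^sup>2)"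
    by (intro sum.mono_neutral_cong_right) auto
  also have "\<dots> = (\<Sum>s<p - d. (cmod (x s))\<^sup>2)"
    by (rule sum.reindex_bij_witness[of _ "\<lambda>s. s + d" "\<lambda>t. t - d"]) auto
  also have "\<dots> \<le> (\<Sum>s<p. (cmod (x s))\<^sup>2)"
    by (rule sum_mono2) auto
  finally have "(l2norm p (\<lambda>t. if t < d then 0 else x (t - d)))\<^sup>2 \<le> (l2norm p x)\<^sup>2"
    by (simp add: l2norm_power2)
  thus ?thesis by (rule power2_le_imp_le) simp
qed

lemma arr_apply_0 [simp]: "arr_apply q m (\<lambda>_. 0) = (\<lambda>_. 0)"
  by (rule ext) (simp add: arr_apply_def)

lemma arr_apply_scale: "arr_apply q m (\<lambda>s. c * x s) = (\<lambda>t. c * arr_apply q m x t)"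
  by (auto simp: arr_apply_def sum_distrib_left mult_ac)

text \<open>A crude bound, wanted only to make the supremum in \<open>arr_norm\<close> finite and to
  send vectors of norm 0 to norm 0.\<close>

lemma l2norm_arr_apply_le: "l2norm p (arr_apply q m x) \<le> (\<Sum>t<p. l2norm q (m t)) * l2norm q x"
proof -
  have "l2norm p (arr_apply q m x) \<le> (\<Sum>t<p. cmod (arr_apply q m x t))"
    unfolding l2norm_def by (rule L2_set_le_sum) simp
  also have "\<dots> \<le> (\<Sum>t<p. l2norm q (m t) * l2norm q x)"
    unfolding arr_apply_def by (intro sum_mono l2norm_Cauchy_Schwarz)
  finally show ?thesis by (simp add: sum_distrib_right)
qed

lemma bdd_above_arr_norm: "bdd_above ((\<lambda>x. l2norm p (arr_apply q m x)) ` {x. l2norm q x \<le> 1})"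
proof (rule bdd_aboveI2)
  fix x assume "x \<in> {x. l2norm q x \<le> 1}"
  hence "(\<Sum>t<p. l2norm q (m t)) * l2norm q x \<le> (\<Sum>t<p. l2norm q (m t)) * 1"
    by (intro mult_left_mono sum_nonneg) auto
  thus "l2norm p (arr_apply q m x) \<le> (\<Sum>t<p. l2norm q (m t))"
    using l2norm_arr_apply_le[of p q m x] by simp
qed

lemma l2norm_arr_apply_le_arr_norm: "l2norm p (arr_apply q m x) \<le> arr_norm p q m * l2norm q x"
proof (cases "l2norm q x = 0")
  case True
  thus ?thesis using l2norm_arr_apply_le[of p q m x] by simp
next
  case False
  define c where "c = complex_of_real (inverse (l2norm q x))"
  have pos: "l2norm q x > 0" using False l2norm_nonneg[of q x] by linarith
  have "l2norm q (\<lambda>s. c * x s) = 1"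
    using pos unfolding l2norm_scale c_def norm_of_real by simp
  hence "l2norm p (arr_apply q m (\<lambda>s. c * x s)) \<le> arr_norm p q m"
    unfolding arr_norm_def by (intro cSUP_upper bdd_above_arr_norm) simp
  hence "inverse (l2norm q x) * l2norm p (arr_apply q m x) \<le> arr_norm p q m"
    using pos unfolding arr_apply_scale l2norm_scale c_def norm_of_real by simp
  thus ?thesis using pos by (simp add: field_simps)
qed

lemma arr_norm_nonneg: "0 \<le> arr_norm p q m"
proof -
  have "l2norm p (arr_apply q m (\<lambda>_. 0)) \<le> arr_norm p q m"
    unfolding arr_norm_def by (intro cSUP_upper bdd_above_arr_norm) simp
  thus ?thesis using l2norm_nonneg order_trans by blast
qed

lemma arr_norm_le:
  assumes "\<And>x. l2norm p (arr_apply q m x) \<le> K * l2norm q x" "0 \<le> K"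
  shows "arr_norm p q m \<le> K"
  unfolding arr_norm_def
proof (rule cSUP_least)
  show "{x. l2norm q x \<le> 1} \<noteq> {}" by (auto intro: exI[of _ "\<lambda>_. 0"])
next
  fix x assume "x \<in> {x. l2norm q x \<le> 1}"
  thus "l2norm p (arr_apply q m x) \<le> K"
    using assms(1)[of x] mult_left_mono[of "l2norm q x" 1 K] assms(2) by auto
qed

lemma arr_norm_cong: "(\<And>t s. t < p \<Longrightarrow> s < q \<Longrightarrow> m t s = m' t s) \<Longrightarrow> arr_norm p q m = arr_norm p q m'"
  unfolding arr_norm_def by (intro arg_cong[of _ _ Sup] image_cong refl l2norm_cong) (auto simp: arr_apply_def)

lemma arr_norm_scale: "arr_norm p q (\<lambda>t s. c * m t s) = cmod c * arr_norm p q m"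
proof -
  have le: "arr_norm p q (\<lambda>t s. c * m t s) \<le> cmod c * arr_norm p q m" for c m
  proof (rule arr_norm_le)
    fix x
    have "arr_apply q (\<lambda>t s. c * m t s) x = (\<lambda>t. c * arr_apply q m x t)"
      by (auto simp: arr_apply_def sum_distrib_left mult_ac)
    thus "l2norm p (arr_apply q (\<lambda>t s. c * m t s) x) \<le> cmod c * arr_norm p q m * l2norm q x"
      using mult_left_mono[OF l2norm_arr_apply_le_arr_norm[of p q m x], of "cmod c"] by (simp add: l2norm_scale mult_ac)
  qed (simp add: arr_norm_nonneg)
  show ?thesis
  proof (cases "c = 0")
    case True
    thus ?thesis using le[of c m] arr_norm_nonneg[of p q "\<lambda>t s. c * m t s"] by simp
  next
    case False
    \<comment> \<open>The inequality already shown, for the factor \<open>inverse c\<close> and the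
      scaled array, yields the opposite direction.\<close>
    have "arr_norm p q (\<lambda>t s. inverse c * (c * m t s)) \<le> cmod (inverse c) * arr_norm p q (\<lambda>t s. c * m t s)"
      by (rule le)
    moreover have "cmod c > 0" using False by simp
    ultimately have "cmod c * arr_norm p q m \<le> arr_norm p q (\<lambda>t s. c * m t s)"
      using False by (simp add: norm_divide field_simps flip: mult.assoc)
    thus ?thesis using le[of c m] by simp
  qed
qed

text \<open>Duality: with \<open>y = M x\<close>, the square of the norm of \<open>y\<close> is the
  pairing of \<open>x\<close> with the transpose applied to the conjugate of \<open>y\<close>.
  Cauchy-Schwarz and cancelling one factor give one inequality, and exchanging roles gives the
  other. Conjugation sits on the vector, so the plain transpose suffices.\<close>

lemma arr_norm_transpose: "arr_norm q p (\<lambda>s t. m t s) = arr_norm p q m"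
proof -
  have "arr_norm p q m \<le> arr_norm q p (\<lambda>s t. m t s)" for p q m
  proof (rule arr_norm_le)
    fix x
    let ?y = "arr_apply q m x" and ?K = "arr_norm q p (\<lambda>s t. m t s)"
    let ?z = "arr_apply p (\<lambda>s t. m t s) (\<lambda>t. cnj (?y t))"
    have "complex_of_real ((l2norm p ?y)\<^sup>2) = (\<Sum>t<p. ?y t * cnj (?y t))"
      unfolding l2norm_power2 of_real_sum complex_norm_square ..
    also have "\<dots> = (\<Sum>t<p. \<Sum>s<q. m t s * x s * cnj (?y t))"
      by (intro sum.cong refl, subst arr_apply_def) (simp add: sum_distrib_right)
    also have "\<dots> = (\<Sum>s<q. \<Sum>t<p. m t s * x s * cnj (?y t))"
      by (rule sum.swap)
    also have "\<dots> = (\<Sum>s<q. ?z s * x s)"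
      by (simp add: arr_apply_def[of p "\<lambda>s t. m t s"] sum_distrib_left sum_distrib_right mult_ac)
    finally have "complex_of_real ((l2norm p ?y)\<^sup>2) = (\<Sum>s<q. ?z s * x s)" .
    from arg_cong[OF this, of cmod] have "(l2norm p ?y)\<^sup>2 = cmod (\<Sum>s<q. ?z s * x s)"
      unfolding norm_of_real by simp
    also have "\<dots> \<le> l2norm q ?z * l2norm q x" by (rule l2norm_Cauchy_Schwarz)
    also have "\<dots> \<le> (?K * l2norm p ?y) * l2norm q x"
      using l2norm_arr_apply_le_arr_norm[of q p "\<lambda>s t. m t s" "\<lambda>t. cnj (?y t)"]
      by (intro mult_right_mono) (auto simp: l2norm_cnj)
    finally have "l2norm p ?y * l2norm p ?y \<le> l2norm p ?y * (?K * l2norm q x)"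
      by (simp add: power2_eq_square mult_ac)
    thus "l2norm p ?y \<le> ?K * l2norm q x"
      using l2norm_nonneg[of p ?y] mult_nonneg_nonneg[OF arr_norm_nonneg l2norm_nonneg, of q p "\<lambda>s t. m t s" q x]
      by (cases "l2norm p ?y = 0") (auto simp: mult_le_cancel_left)
  qed (rule arr_norm_nonneg)
  from this[of p q m] this[of q p "\<lambda>s t. m t s"] show ?thesis by simp
qed

text \<open>Permutations preserve the norm; reordering the input by the inverse of \<open>g\<close>
  undoes the column permutation.\<close>

lemma arr_norm_permute_le:
  assumes "bij_betw f {..<p} {..<p}" "bij_betw g {..<q} {..<q}"
  shows "arr_norm p q (\<lambda>t s. m (f t) (g s)) \<le> arr_norm p q m"
proof (rule arr_norm_le)
  fix x :: "nat \<Rightarrow> complex"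
  define g' where "g' = the_inv_into {..<q} g"
  have g': "g' (g s) = s" if "s < q" for s
    using assms(2) that unfolding g'_def bij_betw_def by (auto intro: the_inv_into_f_f)
  have perm: "l2norm r (\<lambda>t. y (h t)) = l2norm r y" if "bij_betw h {..<r} {..<r}" for r h y
    unfolding l2norm_def L2_set_def using sum.reindex_bij_betw[OF that, of "\<lambda>t. (cmod (y t))\<^sup>2"] by simp
  let ?z = "\<lambda>s. x (g' s)"
  have eq: "arr_apply q (\<lambda>t s. m (f t) (g s)) x t = arr_apply q m ?z (f t)" for t
    using sum.reindex_bij_betw[OF assms(2), of "\<lambda>s. m (f t) s * ?z s"] by (simp add: arr_apply_def g')
  have "l2norm p (arr_apply q (\<lambda>t s. m (f t) (g s)) x) = l2norm p (\<lambda>t. arr_apply q m ?z (f t))"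
    by (intro l2norm_cong eq)
  also have "\<dots> = l2norm p (arr_apply q m ?z)" by (rule perm[OF assms(1)])
  also have "\<dots> \<le> arr_norm p q m * l2norm q ?z" by (rule l2norm_arr_apply_le_arr_norm)
  also have "l2norm q ?z = l2norm q (\<lambda>s. ?z (g s))" by (rule perm[OF assms(2), symmetric])
  also have "\<dots> = l2norm q x" by (rule l2norm_cong) (simp add: g')
  finally show "l2norm p (arr_apply q (\<lambda>t s. m (f t) (g s)) x) \<le> arr_norm p q m * l2norm q x" .
qed (rule arr_norm_nonneg)

lemma arr_norm_ge_entry:
  assumes "t < p" "s < q"
  shows "cmod (m t s) \<le> arr_norm p q m"
proof -
  define x :: "nat \<Rightarrow> complex" where "x = (\<lambda>j. if j = s then 1 else 0)"
  have "arr_apply q m x t = m t s"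
    using assms by (simp add: arr_apply_def x_def if_distrib cong: if_cong)
  moreover have "(\<Sum>j<q. (cmod (x j))\<^sup>2) = (\<Sum>j<q. if j = s then 1 else 0)"
    by (intro sum.cong) (auto simp: x_def)
  hence "l2norm q x = 1"
    using assms by (simp add: l2norm_def L2_set_def)
  ultimately show ?thesis
    using l2norm_ge[OF assms(1), of "arr_apply q m x"] l2norm_arr_apply_le_arr_norm[of p q m x] by simp
qed

subsection \<open>Scalar propagators and their norms\<close>

text \<open>With \<open>B\<close> the scalar version of \<open>B\<^sub>\<Delta>\<close> and \<open>S\<close> the shift by one time point, \<open>coarse_kernel \<mu> d\<close> is
  \<open>B\<^sup>-\<^sup>1 S\<^sup>d\<close>; \<open>d = 0\<close> is the coarse solve, \<open>d = 1\<close> belongs to F- and \<open>d = 2\<close> to FCF-relaxation.\<close>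

definition coarse_kernel :: "complex \<Rightarrow> nat \<Rightarrow> nat \<Rightarrow> nat \<Rightarrow> complex" where
  "coarse_kernel \<mu> d i j = (if j + d \<le> i then \<mu> ^ (i - j - d) else 0)"

text \<open>F-points come first: index \<open>t < NF\<close> is the F-point in the coarse interval \<open>t div (k - 1)\<close> at
  distance \<open>t mod (k - 1) + 1\<close> after its left C-point, and index \<open>NF + j\<close> is the \<open>j\<close>-th C-point.\<close>

definition err_kernel :: "nat \<Rightarrow> nat \<Rightarrow> nat \<Rightarrow> complex \<Rightarrow> complex \<Rightarrow> nat \<Rightarrow> nat \<Rightarrow> complex" where
  "err_kernel k Nc d l \<mu> t s = (let NF = (Nc - 1) * (k - 1) in
     if s < NF then 0
     else if t < NF then l ^ (t mod (k - 1) + 1) * coarse_kernel \<mu> d (t div (k - 1)) (s - NF)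
     else coarse_kernel \<mu> d (t - NF) (s - NF))"

definition res_kernel :: "nat \<Rightarrow> nat \<Rightarrow> nat \<Rightarrow> complex \<Rightarrow> complex \<Rightarrow> nat \<Rightarrow> nat \<Rightarrow> complex" where
  "res_kernel k Nc d l \<mu> t s = (let NF = (Nc - 1) * (k - 1) in
     if t < NF then 0
     else if s < NF then coarse_kernel \<mu> d (t - NF) (s div (k - 1) + 1) * l ^ (k - 1 - s mod (k - 1))
     else coarse_kernel \<mu> d (t - NF) (s - NF))"

text \<open>Row \<open>j\<close> of the identity
  \<open>B (B\<^sup>-\<^sup>1 S\<^sup>d) = S\<^sup>d\<close>.\<close>

lemma coarse_kernel_rec:
  "coarse_kernel \<mu> d j l = (if l + d = j then 1 else 0) + \<mu> * (if j < 1 then 0 else coarse_kernel \<mu> d (j - 1) l)"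
proof (cases "l + d < j")
  case True
  then obtain e where "j = Suc (l + d + e)" by (metis less_iff_Suc_add)
  thus ?thesis by (simp add: coarse_kernel_def)
qed (auto simp: coarse_kernel_def)

lemma arr_apply_coarse_kernel:
  assumes "j < N"
  shows "arr_apply N (coarse_kernel \<mu> d) x j = (if j < d then 0 else x (j - d)) +
    \<mu> * (if j < 1 then 0 else arr_apply N (coarse_kernel \<mu> d) x (j - 1))"
proof -
  have "(\<Sum>l<N. (if l + d = j then 1 else 0) * x l) = (if j < d then 0 else x (j - d))"
  proof (cases "j < d")
    case False
    have "(\<Sum>l<N. (if l + d = j then 1 else 0) * x l) = (\<Sum>l<N. if l = j - d then x l else 0)"
      using False by (intro sum.cong) auto
    thus ?thesis using False assms by simp
  qed (auto intro!: sum.neutral)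
  thus ?thesis
    unfolding arr_apply_def
    by (subst coarse_kernel_rec, cases "j < 1") (simp_all only: distrib_right sum.distrib sum_distrib_left mult.assoc if_False if_True mult_zero_left mult_zero_right sum.neutral_const)
qed

lemma l2norm_arr_apply_coarse_kernel_le:
  assumes "cmod \<mu> < 1"
  shows "l2norm N (arr_apply N (coarse_kernel \<mu> d) x) \<le> l2norm N x / (1 - cmod \<mu>)"
proof -
  let ?y = "arr_apply N (coarse_kernel \<mu> d) x"
  have "l2norm N ?y = l2norm N (\<lambda>j. (if j < d then 0 else x (j - d)) + \<mu> * (if j < 1 then 0 else ?y (j - 1)))"
    by (intro l2norm_cong arr_apply_coarse_kernel)
  also have "\<dots> \<le> l2norm N (\<lambda>j. if j < d then 0 else x (j - d)) + cmod \<mu> * l2norm N (\<lambda>j. if j < 1 then 0 else ?y (j - 1))"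
    by (rule order_trans[OF l2norm_triangle]) (simp only: l2norm_scale order_refl)
  also have "\<dots> \<le> l2norm N x + cmod \<mu> * l2norm N ?y"
    by (intro add_mono mult_left_mono l2norm_shift) simp
  finally show ?thesis using assms by (simp add: field_simps)
qed

text \<open>The coarse value \<open>y j\<close> reappears at the F-points of interval
  \<open>j\<close> with factors \<open>l, ..., l^(k-1)\<close>. The last C-point is the final time
  point and has no such interval. Being an identity, it serves both the upper and the lower
  bound.\<close>

lemma l2norm_err_kernel:
  fixes l \<mu> :: complex and x :: "nat \<Rightarrow> complex" and d :: nat
  assumes "k \<ge> 1" "Nc \<ge> 1"
  defines "NF \<equiv> (Nc - 1) * (k - 1)"
  defines "y \<equiv> arr_apply Nc (coarse_kernel \<mu> d) (\<lambda>j. x (NF + j))"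
  shows "(l2norm (NF + Nc) (arr_apply (NF + Nc) (err_kernel k Nc d l \<mu>) x))\<^sup>2 =
    (\<Sum>m<k. (cmod l) ^ (2 * m)) * (\<Sum>j<Nc - 1. (cmod (y j))\<^sup>2) + (cmod (y (Nc - 1)))\<^sup>2"
proof -
  let ?z = "arr_apply (NF + Nc) (err_kernel k Nc d l \<mu>) x"
  have split: "(\<Sum>t<NF + Nc. f t) = (\<Sum>t<NF. f t) + (\<Sum>j<Nc. f (NF + j))" for f :: "nat \<Rightarrow> 'b::comm_monoid_add"
    by (simp add: sum.nat_group sum_up_index_split lessThan_Suc_atMost flip: atLeast0LessThan) 
       (simp add: sum.atLeastLessThan_concat[of 0 NF "NF + Nc", symmetric] sum.atLeastLessThan_shift_0[of _ NF] add.commute)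
  have err_kernel: "err_kernel k Nc d l \<mu> t s = (if s < NF then 0
      else if t < NF then l ^ (t mod (k - 1) + 1) * coarse_kernel \<mu> d (t div (k - 1)) (s - NF)
      else coarse_kernel \<mu> d (t - NF) (s - NF))" for t s
    by (simp only: err_kernel_def NF_def Let_def)
  have zF: "?z t = l ^ (t mod (k - 1) + 1) * y (t div (k - 1))" if "t < NF" for t
    using that unfolding arr_apply_def split y_def
    by (simp add: err_kernel sum_distrib_left mult.assoc)
  have zC: "?z (NF + j) = y j" for j
    unfolding arr_apply_def split y_def by (simp add: err_kernel)
  have "(l2norm (NF + Nc) ?z)\<^sup>2 = (\<Sum>t<NF. (cmod (l ^ (t mod (k - 1) + 1) * y (t div (k - 1))))\<^sup>2) + (\<Sum>j<Nc. (cmod (y j))\<^sup>2)"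
    unfolding l2norm_power2 split by (simp add: zF zC)
  also have "(\<Sum>t<NF. (cmod (l ^ (t mod (k - 1) + 1) * y (t div (k - 1))))\<^sup>2) =
     (\<Sum>j<Nc - 1. \<Sum>m<k - 1. (cmod (l ^ (m + 1) * y j))\<^sup>2)"
    unfolding NF_def by (rule sum_div_mod)
  also have "\<dots> = (\<Sum>m<k - 1. (cmod l) ^ (2 * Suc m)) * (\<Sum>j<Nc - 1. (cmod (y j))\<^sup>2)"
    unfolding sum_product
    by (subst sum.swap)
      (simp only: norm_mult norm_power power_mult_distrib power_mult[symmetric] mult.commute[of _ 2] Suc_eq_plus1)
  \<comment> \<open>The missing term \<open>m = 0\<close> is the C-point itself.\<close>
  also have "(\<Sum>m<k - 1. (cmod l) ^ (2 * Suc m)) = (\<Sum>m<k. (cmod l) ^ (2 * m)) - 1"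
    using assms(1) by (cases k) (simp_all only: sum.lessThan_Suc_shift, simp_all)
  also have "(\<Sum>j<Nc. (cmod (y j))\<^sup>2) = (\<Sum>j<Nc - 1. (cmod (y j))\<^sup>2) + (cmod (y (Nc - 1)))\<^sup>2"
    using assms(2) by (cases Nc) auto
  finally show ?thesis by (simp add: algebra_simps)
qed

lemma arr_norm_err_kernel_le:
  assumes "k \<ge> 1" "Nc \<ge> 1" "cmod \<mu> < 1"
  defines "N \<equiv> (Nc - 1) * (k - 1) + Nc"
  shows "arr_norm N N (err_kernel k Nc d l \<mu>) \<le> sqrt (\<Sum>m<k. (cmod l) ^ (2 * m)) / (1 - cmod \<mu>)"
proof (rule arr_norm_le)
  fix x :: "nat \<Rightarrow> complex"
  define NF where "NF = (Nc - 1) * (k - 1)"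
  have N: "N = NF + Nc" by (simp only: N_def NF_def)
  define C where "C = (\<Sum>m<k. (cmod l) ^ (2 * m))"
  define x' where "x' = (\<lambda>j. x (NF + j))"
  define y where "y = arr_apply Nc (coarse_kernel \<mu> d) x'"
  have C: "C \<ge> 1"
    using member_le_sum[of 0 "{..<k}" "\<lambda>m. (cmod l) ^ (2 * m)"] assms(1) by (simp add: C_def)
  have "(l2norm N (arr_apply N (err_kernel k Nc d l \<mu>) x))\<^sup>2 = C * (\<Sum>j<Nc - 1. (cmod (y j))\<^sup>2) + (cmod (y (Nc - 1)))\<^sup>2"
    unfolding N_def C_def y_def x'_def NF_def by (rule l2norm_err_kernel[OF assms(1,2)])
  \<comment> \<open>Raising the weight of the last coarse point from 1 to \<open>C\<close> completes
    the full coarse norm.\<close>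
  also have "\<dots> \<le> C * (\<Sum>j<Nc - 1. (cmod (y j))\<^sup>2) + C * (cmod (y (Nc - 1)))\<^sup>2"
    using C mult_right_mono[of 1 C "(cmod (y (Nc - 1)))\<^sup>2"] by simp
  also have "\<dots> = C * (l2norm Nc y)\<^sup>2"
    using assms(2) unfolding l2norm_power2 by (cases Nc) (auto simp: algebra_simps)
  also have "\<dots> = (sqrt C * l2norm Nc y)\<^sup>2"
    using C by (simp add: power_mult_distrib)
  finally have *: "l2norm N (arr_apply N (err_kernel k Nc d l \<mu>) x) \<le> sqrt C * l2norm Nc y"
    by (rule power2_le_imp_le) (use C in simp)
  have "(l2norm Nc x')\<^sup>2 \<le> (l2norm N x)\<^sup>2"
  proof -
    have "(l2norm Nc x')\<^sup>2 = (\<Sum>s=NF..<N. (cmod (x s))\<^sup>2)"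
      unfolding l2norm_power2 x'_def N
      by (rule sum.reindex_bij_witness[of _ "\<lambda>s. s - NF" "\<lambda>j. NF + j"]) auto
    also have "\<dots> \<le> (l2norm N x)\<^sup>2"
      unfolding l2norm_power2 by (rule sum_mono2) auto
    finally show ?thesis .
  qed
  hence "l2norm Nc x' \<le> l2norm N x" by (rule power2_le_imp_le) simp
  hence "l2norm Nc y \<le> l2norm N x / (1 - cmod \<mu>)"
    using l2norm_arr_apply_coarse_kernel_le[OF assms(3), of Nc d x'] assms(3) unfolding y_def
    by (elim order_trans) (simp add: divide_right_mono)
  hence "sqrt C * l2norm Nc y \<le> sqrt C * (l2norm N x / (1 - cmod \<mu>))"
    using C by (intro mult_left_mono) auto
  thus "l2norm N (arr_apply N (err_kernel k Nc d l \<mu>) x) \<le> sqrt C / (1 - cmod \<mu>) * l2norm N x"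
    using * by simp
qed (use assms in \<open>auto intro!: divide_nonneg_pos sum_nonneg\<close>)

lemma arr_norm_err_kernel_ge:
  assumes "k \<ge> 1" "Nc \<ge> 1" "cmod \<mu> < 1"
  defines "N \<equiv> (Nc - 1) * (k - 1) + Nc"
  shows "(\<Sum>m<k. (cmod l) ^ (2 * m)) * (real Nc - (1 + real d + 2 / (1 - cmod \<mu>))) / (1 - cmod \<mu>)\<^sup>2
    \<le> (arr_norm N N (err_kernel k Nc d l \<mu>))\<^sup>2 * real Nc"
proof -
  define NF where "NF = (Nc - 1) * (k - 1)"
  define C where "C = (\<Sum>m<k. (cmod l) ^ (2 * m))"
  define r where "r = cmod \<mu>"
  have r: "0 \<le> r" "r < 1" using assms(3) by (auto simp: r_def)
  have C: "C \<ge> 0" by (auto simp: C_def sum_nonneg)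
  \<comment> \<open>Testing with the powers of the phase of \<open>\<mu>\<close> makes all terms of \<open>y j\<close> point in the same direction.\<close>
  define \<omega> where "\<omega> = cis (Arg \<mu>)"
  \<comment> \<open>\<open>cis\<close> has modulus 1 also when \<mu> = 0, so no case distinction is
    required.\<close>
  have \<omega>: "cmod \<omega> = 1" "\<mu> = of_real r * \<omega>"
    using rcis_cmod_Arg[of \<mu>] by (auto simp: \<omega>_def r_def rcis_def)
  define x where "x = (\<lambda>s. if s < NF then 0 else \<omega> ^ (s - NF))"
  define y where "y = arr_apply Nc (coarse_kernel \<mu> d) (\<lambda>j. x (NF + j))"
  have vx: "(l2norm N x)\<^sup>2 = real Nc"
  proof -
    have "(l2norm N x)\<^sup>2 = (\<Sum>s<N. if s < NF then 0 else 1)"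
      unfolding l2norm_power2 by (intro sum.cong) (auto simp: x_def norm_power \<omega>)
    also have "\<dots> = (\<Sum>s=NF..<N. 1)"
      by (intro sum.mono_neutral_cong_right) auto
    finally show ?thesis by (simp add: N_def NF_def)
  qed
  have y: "cmod (y j) = (\<Sum>i<Suc (j - d). r ^ i)" if "d \<le> j" "j < Nc" for j
  proof -
    have "y j = (\<Sum>i<Nc. if i + d \<le> j then \<mu> ^ (j - i - d) * \<omega> ^ i else 0)"
      unfolding y_def arr_apply_def x_def coarse_kernel_def by (intro sum.cong) auto
    also have "\<dots> = (\<Sum>i<Suc (j - d). \<mu> ^ (j - i - d) * \<omega> ^ i)"
      using that by (intro sum.mono_neutral_cong_right) auto
    also have "\<dots> = (\<Sum>i<Suc (j - d). \<omega> ^ (j - d) * of_real r ^ (j - d - i))"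
    proof (intro sum.cong refl)
      fix i assume "i \<in> {..<Suc (j - d)}"
      hence i: "i \<le> j - d" by simp
      have "\<mu> ^ (j - i - d) * \<omega> ^ i = of_real r ^ (j - d - i) * (\<omega> ^ (j - d - i) * \<omega> ^ i)"
        unfolding diff_commute[of j i d] by (subst \<omega>(2)) (simp only: power_mult_distrib mult.assoc)
      also have "\<omega> ^ (j - d - i) * \<omega> ^ i = \<omega> ^ (j - d)"
        using i by (simp only: power_add[symmetric] le_add_diff_inverse2)
      finally show "\<mu> ^ (j - i - d) * \<omega> ^ i = \<omega> ^ (j - d) * of_real r ^ (j - d - i)"
        by (simp only: mult.commute)
    qed
    also have "\<dots> = \<omega> ^ (j - d) * of_real (\<Sum>i<Suc (j - d). r ^ (j - d - i))"
      by (simp only: sum_distrib_left of_real_sum of_real_power)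
    also have "(\<Sum>i<Suc (j - d). r ^ (j - d - i)) = (\<Sum>i<Suc (j - d). r ^ i)"
      by (rule sum.reindex_bij_witness[of _ "\<lambda>i. j - d - i" "\<lambda>i. j - d - i"]) auto
    finally have "cmod (y j) = \<bar>\<Sum>i<Suc (j - d). r ^ i\<bar>"
      by (simp only: norm_mult norm_power \<omega>(1) norm_of_real power_one mult_1)
    thus ?thesis using r by (simp add: sum_nonneg)
  qed
  \<comment> \<open>Dropping the square of the correction leaves it linear in a power of
    \<open>r\<close>, so its sum over all rows is bounded by a geometric series.\<close>
  have ylow: "(1 - 2 * r ^ Suc (j - d)) / (1 - r)\<^sup>2 \<le> (cmod (y j))\<^sup>2" if "d \<le> j" "j < Nc" for j
  proof -
    have "cmod (y j) = (1 - r ^ Suc (j - d)) / (1 - r)"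
      using y[OF that] r by (simp only: sum_gp_strict) simp
    hence "(cmod (y j))\<^sup>2 = (1 - r ^ Suc (j - d))\<^sup>2 / (1 - r)\<^sup>2"
      by (simp add: power_divide)
    moreover have "1 - 2 * r ^ Suc (j - d) \<le> (1 - r ^ Suc (j - d))\<^sup>2"
      by (simp add: power2_diff)
    ultimately show ?thesis by (simp only: divide_right_mono zero_le_power2)
  qed
  have "(real Nc - (1 + real d + 2 / (1 - r))) / (1 - r)\<^sup>2 \<le>
      (\<Sum>i<Nc - 1 - d. (1 - 2 * r ^ Suc i) / (1 - r)\<^sup>2)"
  proof -
    have "(\<Sum>i<Nc - 1 - d. r ^ Suc i) \<le> (\<Sum>i<Nc - 1 - d. r ^ i)"
      using r by (intro sum_mono power_decreasing) auto
    also have "\<dots> \<le> 1 / (1 - r)"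
      using r by (simp add: sum_gp_strict divide_right_mono)
    finally have "real (Nc - 1 - d) - 2 * (1 / (1 - r)) \<le> (\<Sum>i<Nc - 1 - d. 1 - 2 * r ^ Suc i)"
      by (simp only: sum_subtractf sum_distrib_left[symmetric]) simp
    moreover have "real Nc - 1 - real d \<le> real (Nc - 1 - d)" by linarith
    ultimately have "real Nc - (1 + real d + 2 / (1 - r)) \<le> (\<Sum>i<Nc - 1 - d. 1 - 2 * r ^ Suc i)"
      by simp
    thus ?thesis by (simp only: sum_divide_distrib[symmetric] divide_right_mono zero_le_power2)
  qed
  also have "\<dots> = (\<Sum>j=d..<Nc - 1. (1 - 2 * r ^ Suc (j - d)) / (1 - r)\<^sup>2)"
    by (rule sum.reindex_bij_witness[of _ "\<lambda>j. j - d" "\<lambda>i. i + d"]) auto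
  also have "\<dots> \<le> (\<Sum>j=d..<Nc - 1. (cmod (y j))\<^sup>2)"
    by (intro sum_mono ylow) auto
  also have "\<dots> \<le> (\<Sum>j<Nc - 1. (cmod (y j))\<^sup>2)"
    by (rule sum_mono2) auto
  finally have "C * ((real Nc - (1 + real d + 2 / (1 - r))) / (1 - r)\<^sup>2) \<le> C * (\<Sum>j<Nc - 1. (cmod (y j))\<^sup>2)"
    using C by (rule mult_left_mono)
  also have "\<dots> \<le> C * (\<Sum>j<Nc - 1. (cmod (y j))\<^sup>2) + (cmod (y (Nc - 1)))\<^sup>2" by simp
  also have "\<dots> = (l2norm N (arr_apply N (err_kernel k Nc d l \<mu>) x))\<^sup>2"
    unfolding N_def C_def y_def NF_def by (rule l2norm_err_kernel[OF assms(1,2), symmetric])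
  also have "\<dots> \<le> (arr_norm N N (err_kernel k Nc d l \<mu>) * l2norm N x)\<^sup>2"
    by (intro power_mono l2norm_arr_apply_le_arr_norm) simp
  finally show ?thesis
    by (simp add: power_mult_distrib vx C_def r_def)
qed

text \<open>Row \<open>d\<close> of the first coarse column carries \<mu>^0 = 1. That row exists
  only from \<open>d + 1\<close> coarse points on; with fewer the shift annihilates everything. This
  is the source of the thresholds 2 and 3 in the theorem.\<close>

lemma arr_norm_err_kernel_pos:
  fixes k :: nat
  assumes "Nc \<ge> d + 1"
  defines "N \<equiv> (Nc - 1) * (k - 1) + Nc"
  shows "arr_norm N N (err_kernel k Nc d l \<mu>) > 0"
proof -
  let ?NF = "(Nc - 1) * (k - 1)"
  have "cmod (err_kernel k Nc d l \<mu> (?NF + d) ?NF) \<le> arr_norm N N (err_kernel k Nc d l \<mu>)"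
    using assms(1) by (intro arr_norm_ge_entry) (auto simp: N_def)
  thus ?thesis by (simp add: err_kernel_def coarse_kernel_def)
qed

text \<open>The upper bound on the norm makes the difference nonnegative. The lower bound loses the
  relative amount \<open>u = K / Nc\<close> in the square, which limits the difference to
  \<open>2 * u * (1 - r)\<close>.\<close>

lemma arr_norm_err_kernel_asymp:
  assumes "k \<ge> 1" "cmod \<mu> < 1"
  shows "(\<lambda>Nc. sqrt (\<Sum>m<k. (cmod l) ^ (2 * m)) /
      arr_norm ((Nc - 1) * (k - 1) + Nc) ((Nc - 1) * (k - 1) + Nc) (err_kernel k Nc d l \<mu>) - (1 - cmod \<mu>))
    \<in> O(\<lambda>Nc. 1 / real Nc)"
proof -
  define r where "r = cmod \<mu>"
  define C where "C = (\<Sum>m<k. (cmod l) ^ (2 * m))"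
  define K where "K = 1 + real d + 2 / (1 - r)"
  define G where "G = (\<lambda>Nc. arr_norm ((Nc - 1) * (k - 1) + Nc) ((Nc - 1) * (k - 1) + Nc) (err_kernel k Nc d l \<mu>))"
  have r: "0 \<le> r" "r < 1" using assms by (auto simp: r_def)
  have C: "C \<ge> 0" by (auto simp: C_def sum_nonneg)
  have K: "K > 0" using r by (auto simp: K_def intro!: add_pos_nonneg)
  have bound: "norm (sqrt C / G Nc - (1 - r)) \<le> 2 * K * (1 - r) * norm (1 / real Nc)"
    if Nc: "Nc \<ge> d + 1" "real Nc \<ge> 2 * K" for Nc
  proof -
    define u where "u = K / real Nc"
    have Nc0: "real Nc > 0" using Nc(1) by simp
    have u: "0 \<le> u" "u \<le> 1 / 2" using Nc K Nc0 by (auto simp: u_def field_simps)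
    have G: "G Nc > 0" unfolding G_def using Nc(1) by (rule arr_norm_err_kernel_pos)
    have "G Nc \<le> sqrt C / (1 - r)"
      unfolding G_def C_def r_def using assms Nc(1) by (intro arr_norm_err_kernel_le) auto
    hence low: "1 - r \<le> sqrt C / G Nc"
      using r G by (simp add: field_simps)
    have "C * (real Nc - K) / (1 - r)\<^sup>2 \<le> (G Nc)\<^sup>2 * real Nc"
      unfolding G_def C_def r_def K_def using assms Nc(1) by (intro arr_norm_err_kernel_ge) auto
    hence "C * (real Nc - K) \<le> (1 - r)\<^sup>2 * (G Nc)\<^sup>2 * real Nc"
      using r by (simp add: field_simps)
    hence "C * (1 - u) \<le> (1 - r)\<^sup>2 * (G Nc)\<^sup>2"
      using Nc0 by (simp add: u_def field_simps)
    hence "C * (1 - u) * (1 + 2 * u)\<^sup>2 \<le> (1 - r)\<^sup>2 * (G Nc)\<^sup>2 * (1 + 2 * u)\<^sup>2"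
      by (rule mult_right_mono) simp
    \<comment> \<open>Replaces 1 / sqrt(1 - u) by the linear bound 1 + 2u. The product expands to 1
      + u(3 - 4u^2), and u \<le> 1/2 comes from the requirement
      \<open>real Nc \<ge> 2 * K\<close>.\<close>
    moreover have "1 \<le> (1 - u) * (1 + 2 * u)\<^sup>2"
    proof -
      have "0 \<le> u * (3 - 4 * u\<^sup>2)"
        using u power_mono[of u "1/2" 2] by (intro mult_nonneg_nonneg) (auto simp: power2_eq_square)
      thus ?thesis by (simp add: power2_eq_square algebra_simps)
    qed
    hence "C * 1 \<le> C * ((1 - u) * (1 + 2 * u)\<^sup>2)"
      using C by (rule mult_left_mono)
    ultimately have "C \<le> ((1 - r) * (1 + 2 * u) * G Nc)\<^sup>2"
      by (simp add: power_mult_distrib mult_ac)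
    hence "sqrt C \<le> (1 - r) * (1 + 2 * u) * G Nc"
      using r u G by (intro real_le_lsqrt) auto
    hence "sqrt C / G Nc \<le> (1 - r) * (1 + 2 * u)"
      using G by (simp add: field_simps)
    hence "sqrt C / G Nc - (1 - r) \<le> (1 - r) * (2 * u)"
      by (simp add: algebra_simps)
    also have "\<dots> = 2 * K * (1 - r) * norm (1 / real Nc)"
      by (simp add: u_def)
    finally show ?thesis using low by simp
  qed
  have "eventually (\<lambda>Nc. norm (sqrt C / G Nc - (1 - r)) \<le> 2 * K * (1 - r) * norm (1 / real Nc)) sequentially"
  proof (rule eventually_sequentiallyI)
    fix Nc assume "Nc \<ge> max (d + 1) (nat \<lceil>2 * K\<rceil>)"
    thus "norm (sqrt C / G Nc - (1 - r)) \<le> 2 * K * (1 - r) * norm (1 / real Nc)"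
      by (intro bound) linarith+
  qed
  from bigoI[OF this] show ?thesis by (simp add: G_def C_def r_def)
qed

lemma arr_norm_res_kernel:
  fixes k :: nat
  assumes "Nc \<ge> 1"
  defines "N \<equiv> (Nc - 1) * (k - 1) + Nc"
  shows "arr_norm N N (res_kernel k Nc d l \<mu>) = arr_norm N N (err_kernel k Nc d l \<mu>)"
proof -
  define NF where "NF = (Nc - 1) * (k - 1)"
  \<comment> \<open>\<open>\<sigma>\<close> reverses time within the F-points and within the C-points; this maps interpolation to the
    transpose of restriction because the last coarse point has no F-points after it and the first
    has none before it.\<close>
  define \<sigma> where "\<sigma> = (\<lambda>t. if t < NF then NF - 1 - t else NF + (N - 1 - t))"
  have N: "N = NF + Nc" by (simp add: N_def NF_def)
  have bij: "bij_betw \<sigma> {..<N} {..<N}"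
    by (rule bij_betw_byWitness[where f' = \<sigma>]) (auto simp: \<sigma>_def N)
  \<comment> \<open>Reversing the enumeration of all F-points reverses the order of the intervals
    and the order inside each interval.\<close>
  have flip: "(NF - 1 - t) div (k - 1) = Nc - 2 - t div (k - 1)"
    "(NF - 1 - t) mod (k - 1) = k - 2 - t mod (k - 1)"
    "t div (k - 1) < Nc - 1" "t mod (k - 1) < k - 1" if "t < NF" for t
  proof -
    let ?q = "t div (k - 1)" and ?m = "t mod (k - 1)"
    have k: "k - 1 > 0"
    proof (rule ccontr)
      assume "\<not> k - 1 > 0"
      hence "k - 1 = 0" by simp
      hence "NF = 0" unfolding NF_def by (simp only: mult_0_right)
      thus False using that by simp
    qed
    show q: "?q < Nc - 1" using that by (simp add: NF_def less_mult_imp_div_less)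
    show m: "?m < k - 1" using k by simp
    \<comment> \<open>The additive complements \<open>a\<close> and \<open>b\<close> replace
      truncated differences, so that uniqueness of division applies.\<close>
    obtain a where a: "Nc - 1 = Suc (?q + a)" using q less_iff_Suc_add by auto
    obtain b where b: "k - 1 = Suc (?m + b)" using m less_iff_Suc_add by auto
    have t: "t = ?q * (k - 1) + ?m" by (rule div_mult_mod_eq[symmetric])
    have "NF = ?q * (k - 1) + a * (k - 1) + (k - 1)"
      unfolding NF_def by (subst a) (simp add: algebra_simps)
    hence e: "NF - 1 - t = a * (k - 1) + b"
      using t b by linarith
    have "b < k - 1" using b by simp
    hence "(NF - 1 - t) div (k - 1) = a" "(NF - 1 - t) mod (k - 1) = b"
      unfolding e by simp_all
    thus "(NF - 1 - t) div (k - 1) = Nc - 2 - ?q" "(NF - 1 - t) mod (k - 1) = k - 2 - ?m"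
      using a b by linarith+
  qed
  have E: "err_kernel k Nc d l \<mu> t s = (if s < NF then 0
      else if t < NF then l ^ (t mod (k - 1) + 1) * coarse_kernel \<mu> d (t div (k - 1)) (s - NF)
      else coarse_kernel \<mu> d (t - NF) (s - NF))" for t s
    by (simp only: err_kernel_def NF_def Let_def)
  have R: "res_kernel k Nc d l \<mu> t s = (if t < NF then 0
      else if s < NF then coarse_kernel \<mu> d (t - NF) (s div (k - 1) + 1) * l ^ (k - 1 - s mod (k - 1))
      else coarse_kernel \<mu> d (t - NF) (s - NF))" for t s
    by (simp only: res_kernel_def NF_def Let_def)
  have swap: "err_kernel k Nc d l \<mu> t s = res_kernel k Nc d l \<mu> (\<sigma> s) (\<sigma> t)" if ts: "t < N" "s < N" for t s
  proof (cases "s < NF")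
    case True
    hence "\<sigma> s < NF" by (simp add: \<sigma>_def)
    thus ?thesis using True by (simp only: E R if_True)
  next
    case False
    hence "\<not> \<sigma> s < NF" by (simp add: \<sigma>_def)
    note e = E[of t s, unfolded if_not_P[OF False]]
      and r = R[of "\<sigma> s" "\<sigma> t", unfolded if_not_P[OF this]]
    \<comment> \<open>A Toeplitz array depends only on \<open>i - j\<close>, which reversing both
      indices and swapping them leaves unchanged.\<close>
    have c: "coarse_kernel \<mu> d i j = coarse_kernel \<mu> d (Nc - 1 - j) (Nc - 1 - i)" if "i < Nc" "j < Nc" for i j
      using that by (auto simp: coarse_kernel_def)
    have s: "\<sigma> s - NF = Nc - 1 - (s - NF)" "s - NF < Nc"
      using False ts by (auto simp: \<sigma>_def N)
    show ?thesis
    proof (cases "t < NF")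
      case True
      hence \<sigma>t: "\<sigma> t < NF" "\<sigma> t = NF - 1 - t" by (auto simp: \<sigma>_def)
      have "k - 1 - (k - 2 - t mod (k - 1)) = t mod (k - 1) + 1"
        "Nc - 2 - t div (k - 1) + 1 = Nc - 1 - t div (k - 1)"
        using flip(3,4)[OF True] by simp_all
      moreover have "coarse_kernel \<mu> d (t div (k - 1)) (s - NF) = coarse_kernel \<mu> d (Nc - 1 - (s - NF)) (Nc - 1 - t div (k - 1))"
        using flip(3)[OF True] s by (intro c) auto
      ultimately show ?thesis
        unfolding e r if_P[OF True] if_P[OF \<sigma>t(1)] by (simp only: \<sigma>t(2) flip(1,2)[OF True] s(1) mult.commute)
    next
      case False
      hence "\<not> \<sigma> t < NF" "\<sigma> t - NF = Nc - 1 - (t - NF)" "t - NF < Nc"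
        using ts by (auto simp: \<sigma>_def N)
      thus ?thesis
        unfolding e r using False s(2) by (simp only: if_False s(1)) (rule c)
    qed
  qed
  \<comment> \<open>\<sigma> is an involution, so \<open>swap\<close> can also be read from residual
    to error, giving the second inequality.\<close>
  have inv: "\<sigma> (\<sigma> t) = t" "\<sigma> t < N" if "t < N" for t
    using that by (auto simp: \<sigma>_def N)
  let ?E = "err_kernel k Nc d l \<mu>" and ?R = "res_kernel k Nc d l \<mu>"
  have "arr_norm N N ?E = arr_norm N N (\<lambda>t s. ?R (\<sigma> s) (\<sigma> t))"
    by (intro arr_norm_cong swap)
  also have "\<dots> = arr_norm N N (\<lambda>t s. ?R (\<sigma> t) (\<sigma> s))"
    by (rule arr_norm_transpose[of N N "\<lambda>t s. ?R (\<sigma> t) (\<sigma> s)"])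
  finally have 1: "arr_norm N N ?E \<le> arr_norm N N ?R"
    using arr_norm_permute_le[OF bij bij, of ?R] by simp
  have "arr_norm N N ?R = arr_norm N N (\<lambda>t s. ?E (\<sigma> s) (\<sigma> t))"
    by (intro arr_norm_cong) (simp add: swap inv)
  also have "\<dots> = arr_norm N N (\<lambda>t s. ?E (\<sigma> t) (\<sigma> s))"
    by (rule arr_norm_transpose[of N N "\<lambda>t s. ?E (\<sigma> t) (\<sigma> s)"])
  finally have 2: "arr_norm N N ?R \<le> arr_norm N N ?E"
    using arr_norm_permute_le[OF bij bij, of ?E] by simp
  from 1 2 show ?thesis by simp
qed

subsection \<open>Matrix inverses, energy norms and submatrices\<close>

text \<open>A right inverse of a square matrix is two-sided, so \<open>mat_inverse\<close> cannot
  return \<open>None\<close>, and uniqueness of inverses identifies its result.\<close>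

lemma mat_inv_eqI:
  assumes A: "A \<in> carrier_mat N N" and B: "B \<in> carrier_mat N N" and AB: "A * B = 1\<^sub>m N"
  shows "mat_inv A = B"
proof (cases "mat_inverse A")
  case None
  have "B * A = 1\<^sub>m N" by (rule mat_mult_left_right_inverse[OF A B AB])
  hence "A \<in> Units (ring_mat TYPE(complex) N ())"
    using A B AB by (auto simp: Units_def ring_mat_simps)
  thus ?thesis using mat_inverse(1)[OF A None, of "()"] by blast
next
  case (Some C)
  from mat_inverse(2)[OF A this] have C: "C * A = 1\<^sub>m N" "C \<in> carrier_mat N N" by auto
  have "C = C * (A * B)" using C AB by simp
  also have "\<dots> = (C * A) * B" by (rule assoc_mult_mat[OF C(2) A B, symmetric])
  also have "\<dots> = B" using C B by simp
  finally show ?thesis by (simp add: mat_inv_def Some)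
qed

lemma dim_mat_adjoint [simp]: "dim_row (mat_adjoint A) = dim_col A" "dim_col (mat_adjoint A) = dim_row A"
  by (auto simp: mat_adjoint_def)

lemma index_mat_adjoint [simp]:
  "i < dim_col A \<Longrightarrow> j < dim_row A \<Longrightarrow> mat_adjoint A $$ (i, j) = conjugate (A $$ (j, i))"
  by (simp add: mat_adjoint_def mat_of_rows_index)

lemma mat_adjoint_mult:
  fixes A B :: "complex mat"
  assumes "A \<in> carrier_mat p q" "B \<in> carrier_mat q r"
  shows "mat_adjoint (A * B) = mat_adjoint B * mat_adjoint A"
  using assms by (intro eq_matI) (auto simp: scalar_prod_def sum_conjugate conjugate_dist_mul mult.commute)

lemma mat_adjoint_one: "mat_adjoint (1\<^sub>m N :: complex mat) = 1\<^sub>m N"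
  by (intro eq_matI) auto

lemma cscalar_prod_adjoint:
  fixes B :: "complex mat"
  assumes B: "B \<in> carrier_mat p q" and w: "w \<in> carrier_vec p" and v: "v \<in> carrier_vec q"
  shows "(mat_adjoint B *\<^sub>v w) \<bullet>c v = w \<bullet>c (B *\<^sub>v v)"
proof -
  have "(mat_adjoint B *\<^sub>v w) \<bullet>c v = (\<Sum>j<q. \<Sum>i<p. cnj (B $$ (i, j)) * w $ i * cnj (v $ j))"
    using assms by (auto simp: scalar_prod_def sum_distrib_right atLeast0LessThan intro!: sum.cong)
  also have "\<dots> = (\<Sum>i<p. \<Sum>j<q. cnj (B $$ (i, j)) * w $ i * cnj (v $ j))"
    by (rule sum.swap)
  also have "\<dots> = w \<bullet>c (B *\<^sub>v v)"
    using assms by (auto simp: scalar_prod_def sum_distrib_left atLeast0LessThan mult_ac intro!: sum.cong)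
  finally show ?thesis .
qed

lemma Re_cscalar_prod_self:
  fixes v :: "complex vec"
  shows "Re (v \<bullet>c v) = (l2norm (dim_vec v) (\<lambda>i. v $ i))\<^sup>2"
proof -
  have "v \<bullet>c v = (\<Sum>i<dim_vec v. v $ i * cnj (v $ i))"
    by (simp add: scalar_prod_def atLeast0LessThan)
  also have "\<dots> = of_real ((l2norm (dim_vec v) (\<lambda>i. v $ i))\<^sup>2)"
    by (simp only: complex_norm_square[symmetric] l2norm_power2 of_real_sum)
  finally show ?thesis by (simp only: Re_complex_of_real)
qed

text \<open>With \<open>B\<close> the inverse of \<open>A\<close>, the weight equals
  \<open>mat_adjoint B * B\<close>, and moving the adjoint across the inner product leaves the plain
  norm of \<open>B v\<close>.\<close>

lemma vnorm_wrt_gram: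
  assumes A: "A \<in> carrier_mat N N" and B: "B \<in> carrier_mat N N" and BA: "B * A = 1\<^sub>m N"
    and v: "v \<in> carrier_vec N"
  shows "vnorm_wrt (mat_inv (A * mat_adjoint A)) v = l2norm N (\<lambda>i. (B *\<^sub>v v) $ i)"
proof -
  have AB: "A * B = 1\<^sub>m N" by (rule mat_mult_left_right_inverse[OF B A BA])
  have adj: "mat_adjoint A \<in> carrier_mat N N" "mat_adjoint B \<in> carrier_mat N N"
    using A B by (auto intro!: carrier_matI)
  have "mat_adjoint A * mat_adjoint B = mat_adjoint (B * A)"
    by (rule mat_adjoint_mult[OF B A, symmetric])
  hence adj1: "mat_adjoint A * mat_adjoint B = 1\<^sub>m N" by (simp add: BA mat_adjoint_one)
  have "A * mat_adjoint A * (mat_adjoint B * B) = A * ((mat_adjoint A * mat_adjoint B) * B)"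
    using A B adj by (simp add: assoc_mult_mat[of _ N N _ N _ N])
  also have "\<dots> = 1\<^sub>m N" using B by (simp add: adj1 AB)
  finally have inv: "mat_inv (A * mat_adjoint A) = mat_adjoint B * B"
    using A B adj by (intro mat_inv_eqI[of _ N]) auto
  have Bv: "B *\<^sub>v v \<in> carrier_vec N" using B v by simp
  have "(mat_adjoint B * B *\<^sub>v v) \<bullet>c v = (mat_adjoint B *\<^sub>v (B *\<^sub>v v)) \<bullet>c v"
    using adj B v by simp
  also have "\<dots> = (B *\<^sub>v v) \<bullet>c (B *\<^sub>v v)"
    by (rule cscalar_prod_adjoint[OF B Bv v])
  finally show ?thesis
    using Bv B unfolding vnorm_wrt_def inv Re_cscalar_prod_self
    by (simp add: Re_cscalar_prod_self)
qed

lemma vnorm_wrt_one: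
  assumes "v \<in> carrier_vec N"
  shows "vnorm_wrt (1\<^sub>m N) v = l2norm N (\<lambda>i. v $ i)"
  using assms by (simp add: vnorm_wrt_def Re_cscalar_prod_self)

text \<open>\<open>pick\<close> enumerates a set by repeatedly taking least elements, hence agrees
  with any strictly increasing enumeration. This gives submatrix entries in closed form.\<close>

lemma pick_strict_mono:
  assumes "strict_mono f" "range f = S"
  shows "pick S i = f i"
proof (induction i)
  case 0
  show ?case unfolding pick.simps
    using assms by (intro Least_equality) (auto simp: strict_mono_less_eq)
next
  case (Suc i)
  show ?case unfolding pick.simps Suc
    using assms by (intro Least_equality) (auto simp: strict_mono_less strict_mono_less_eq)
qed

lemma card_strict_mono:
  assumes "strict_mono f" "range f = S" "\<And>i. f i < N \<longleftrightarrow> i < c"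
  shows "card {i. i < N \<and> i \<in> S} = c"
proof -
  have "{i. i < N \<and> i \<in> S} = f ` {..<c}" using assms(2,3) by auto
  thus ?thesis
    using card_image[OF strict_mono_imp_inj_on[OF assms(1), of "{..<c}"]] by simp
qed

text \<open>Lifts an enumeration of time points to one of scalar indices: these are ordered
  lexicographically by time point, then component.\<close>

lemma block_enum:
  assumes n: "n > (0::nat)" and f: "strict_mono f" "range f = T"
  defines "g \<equiv> \<lambda>r. f (r div n) * n + r mod n"
  shows "strict_mono g" "range g = {r. r div n \<in> T}"
    "(\<And>t. f t < N \<longleftrightarrow> t < c) \<Longrightarrow> g r < N * n \<longleftrightarrow> r < c * n"
proof -
  have div_g: "g r div n = f (r div n)" for r
    using n by (simp add: g_def)
  show "strict_mono g"
  proof (rule strict_monoI)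
    fix r s :: nat assume rs: "r < s"
    show "g r < g s"
    proof (cases "r div n = s div n")
      case True
      hence "r mod n < s mod n"
        using rs by (metis add_less_cancel_left div_mult_mod_eq)
      thus ?thesis using True by (simp add: g_def)
    next
      case False
      hence "r div n < s div n" using rs div_le_mono[of r s n] by linarith
      hence "f (r div n) < f (s div n)" using f(1) by (simp add: strict_mono_less)
      hence "g r div n < g s div n" by (simp add: div_g)
      thus ?thesis by (meson div_le_mono leD leI)
    qed
  qed
  show "range g = {r. r div n \<in> T}"
  proof (intro equalityI subsetI)
    fix r assume "r \<in> range g"
    thus "r \<in> {r. r div n \<in> T}" using f(2) by (auto simp: div_g)
  next
    fix r assume "r \<in> {r. r div n \<in> T}"
    then obtain t where t: "r div n = f t" using f(2) by auto
    have "g (t * n + r mod n) = r" using n by (simp add: g_def t[symmetric])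
    thus "r \<in> range g" by (metis rangeI)
  qed
  show "g r < N * n \<longleftrightarrow> r < c * n" if "\<And>t. f t < N \<longleftrightarrow> t < c"
    using that[of "r div n"] n
    by (simp only: div_less_iff_less_mult[symmetric] div_g)
qed

lemma submatrix_eqI:
  assumes "strict_mono f" "range f = I" "\<And>i. f i < dim_row A \<longleftrightarrow> i < p"
    and "strict_mono g" "range g = J" "\<And>i. g i < dim_col A \<longleftrightarrow> i < q"
  shows "submatrix A I J = mat p q (\<lambda>(i, j). A $$ (f i, g j))"
  unfolding submatrix_def card_strict_mono[OF assms(1-3)] card_strict_mono[OF assms(4-6)]
    pick_strict_mono[OF assms(1,2)] pick_strict_mono[OF assms(4,5)] ..

subsection \<open>Block matrices diagonalized by a common eigenbasis\<close>

definition block_diag :: "nat \<Rightarrow> nat \<Rightarrow> complex mat \<Rightarrow> complex mat" where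
  "block_diag n N X = mat (N * n) (N * n)
     (\<lambda>(r, c). if r div n = c div n then X $$ (r mod n, c mod n) else 0)"

lemma block_diag_carrier [simp]: "block_diag n N X \<in> carrier_mat (N * n) (N * n)"
  by (simp add: block_diag_def)

text \<open>Trades the recursive \<open>diag_block_mat\<close> for the
  \<open>div\<close>/\<open>mod\<close> indexing that \<open>block_bidiag\<close> uses.\<close>

lemma diag_block_mat_replicate:
  assumes X: "X \<in> carrier_mat n n" and n: "n > 0"
  shows "diag_block_mat (replicate N X) = block_diag n N X"
proof (induction N)
  case 0
  show ?case by (intro eq_matI) (auto simp: block_diag_def)
next
  case (Suc N)
  have d: "dim_row X = n" "dim_col X = n" using X by auto
  have dm: "r div n = 0 \<and> r mod n = r \<or> r div n = Suc ((r - n) div n) \<and> r mod n = (r - n) mod n \<and> \<not> r < n" for r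
    using n by (cases "r < n") (auto simp: le_div_geq le_mod_geq)
  have "diag_block_mat (replicate (Suc N) X) =
      four_block_mat X (0\<^sub>m n (N * n)) (0\<^sub>m (N * n) n) (block_diag n N X)"
    by (simp add: Suc.IH d Let_def) (simp add: block_diag_def)
  also have "\<dots> = block_diag n (Suc N) X"
  proof (rule eq_matI)
    fix r c assume "r < dim_row (block_diag n (Suc N) X)" "c < dim_col (block_diag n (Suc N) X)"
    hence rc: "r < n + N * n" "c < n + N * n" by (auto simp: block_diag_def)
    show "four_block_mat X (0\<^sub>m n (N * n)) (0\<^sub>m (N * n) n) (block_diag n N X) $$ (r, c) = block_diag n (Suc N) X $$ (r, c)"
      using rc n d
      by (cases "r < n"; cases "c < n") (auto simp: block_diag_def le_div_geq le_mod_geq not_less)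
  qed (auto simp: block_diag_def d)
  finally show ?case .
qed

lemma div_mod_less:
  assumes "r < p * (n::nat)"
  shows "r div n < p" "r mod n < n"
proof -
  have "n > 0" using assms by (auto intro: gr0I)
  thus "r div n < p" "r mod n < n" using assms by (auto simp: div_less_iff_less_mult)
qed

lemma block_index_less:
  assumes "t < p" "b < (n::nat)"
  shows "t * n + b < p * n"
proof -
  have "t * n + b < Suc t * n" using assms by simp
  also have "\<dots> \<le> p * n" using assms by (intro mult_right_mono) auto
  finally show ?thesis .
qed

lemma sum_blocks:
  fixes f :: "nat \<Rightarrow> 'a::comm_monoid_add"
  shows "(\<Sum>r<p * n. f r) = (\<Sum>t<p. \<Sum>b<n. f (t * n + b))"
  using sum_div_mod[of "\<lambda>t b. f (t * n + b)" n p] by simp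

lemma block_diag_mult_vec:
  assumes v: "v \<in> carrier_vec (N * n)" and r: "r < N * n"
  shows "(block_diag n N X *\<^sub>v v) $ r = (\<Sum>b<n. X $$ (r mod n, b) * v $ (r div n * n + b))"
proof -
  have "(block_diag n N X *\<^sub>v v) $ r = (\<Sum>c<N * n. (if r div n = c div n then X $$ (r mod n, c mod n) else 0) * v $ c)"
    using assms by (auto simp: block_diag_def scalar_prod_def atLeast0LessThan intro!: sum.cong)
  also have "\<dots> = (\<Sum>s<N. \<Sum>b<n. if s = r div n then X $$ (r mod n, b) * v $ (s * n + b) else 0)"
    unfolding sum_blocks by (intro sum.cong refl) auto
  also have "\<dots> = (\<Sum>s<N. if s = r div n then \<Sum>b<n. X $$ (r mod n, b) * v $ (s * n + b) else 0)"
    by (intro sum.cong refl) simp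
  also have "\<dots> = (\<Sum>b<n. X $$ (r mod n, b) * v $ (r div n * n + b))"
    using div_mod_less[OF r] by simp
  finally show ?thesis .
qed

locale eigenbasis =
  fixes n :: nat and U V :: "complex mat"
  assumes n_pos: "n > 0"
    and U: "U \<in> carrier_mat n n" and V: "V \<in> carrier_mat n n"
    and UV: "U * V = 1\<^sub>m n" and VU: "V * U = 1\<^sub>m n"
begin

lemma UV_entry: "b < n \<Longrightarrow> c < n \<Longrightarrow> (\<Sum>a<n. U $$ (b, a) * V $$ (a, c)) = (if b = c then 1 else 0)"
  using arg_cong[OF UV, of "\<lambda>M. M $$ (b, c)"] U V
  by (simp add: scalar_prod_def atLeast0LessThan)

lemma VU_entry: "b < n \<Longrightarrow> c < n \<Longrightarrow> (\<Sum>a<n. V $$ (b, a) * U $$ (a, c)) = (if b = c then 1 else 0)"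
  using arg_cong[OF VU, of "\<lambda>M. M $$ (b, c)"] U V
  by (simp add: scalar_prod_def atLeast0LessThan)

text \<open>The single cancellation \<open>V * U = 1\<^sub>m n\<close>, in the form needed for
  products, for coordinates and for prescribing coordinates.\<close>

lemma contract:
  assumes "a < n"
  shows "(\<Sum>e<n. V $$ (a, e) * (\<Sum>b<n. U $$ (e, b) * y b)) = y a"
proof -
  have "(\<Sum>e<n. V $$ (a, e) * (\<Sum>b<n. U $$ (e, b) * y b)) = (\<Sum>b<n. \<Sum>e<n. V $$ (a, e) * (U $$ (e, b) * y b))"
    unfolding sum_distrib_left by (rule sum.swap)
  also have "\<dots> = (\<Sum>b<n. (\<Sum>e<n. V $$ (a, e) * U $$ (e, b)) * y b)"
    by (simp add: sum_distrib_right mult.assoc)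
  also have "\<dots> = (\<Sum>b<n. if a = b then y b else 0)"
    using assms by (intro sum.cong refl) (simp add: VU_entry)
  finally show ?thesis using assms by simp
qed

text \<open>The \<open>(t, s)\<close> block of \<open>eig_block p q m\<close> is \<open>U diag\<^sub>a (m a t s) U\<^sup>-\<^sup>1\<close>.\<close>

definition eig_block :: "nat \<Rightarrow> nat \<Rightarrow> (nat \<Rightarrow> nat \<Rightarrow> nat \<Rightarrow> complex) \<Rightarrow> complex mat" where
  "eig_block p q m = mat (p * n) (q * n)
     (\<lambda>(r, c). \<Sum>a<n. U $$ (r mod n, a) * m a (r div n) (c div n) * V $$ (a, c mod n))"

lemma eig_block_carrier [simp]: "eig_block p q m \<in> carrier_mat (p * n) (q * n)"
  by (simp add: eig_block_def)

lemma dim_eig_block [simp]: "dim_row (eig_block p q m) = p * n" "dim_col (eig_block p q m) = q * n"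
  by (simp_all add: eig_block_def)

lemma eig_block_index:
  "r < p * n \<Longrightarrow> c < q * n \<Longrightarrow>
    eig_block p q m $$ (r, c) = (\<Sum>a<n. U $$ (r mod n, a) * m a (r div n) (c div n) * V $$ (a, c mod n))"
  by (simp add: eig_block_def)

lemma eig_block_cong:
  assumes "\<And>a t s. a < n \<Longrightarrow> t < p \<Longrightarrow> s < q \<Longrightarrow> m a t s = m' a t s"
  shows "eig_block p q m = eig_block p q m'"
  using assms by (intro eq_matI) (auto simp: eig_block_index div_mod_less intro!: sum.cong)

text \<open>The factors \<open>V\<close> and \<open>U\<close> of adjacent blocks cancel, so matrix
  products become products of scalar arrays, one for each eigenvector.\<close>

lemma eig_block_mult: "eig_block p q m * eig_block q s m' = eig_block p s (\<lambda>a t u. \<Sum>j<q. m a t j * m' a j u)"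
proof (rule eq_matI)
  fix r c assume "r < dim_row (eig_block p s (\<lambda>a t u. \<Sum>j<q. m a t j * m' a j u))"
    "c < dim_col (eig_block p s (\<lambda>a t u. \<Sum>j<q. m a t j * m' a j u))"
  hence rc: "r < p * n" "c < s * n" by auto
  let ?t = "r div n" and ?u = "c div n"
  have "(eig_block p q m * eig_block q s m') $$ (r, c) = (\<Sum>i<q * n. eig_block p q m $$ (r, i) * eig_block q s m' $$ (i, c))"
    using rc by (simp add: scalar_prod_def atLeast0LessThan)
  also have "\<dots> = (\<Sum>j<q. \<Sum>e<n. eig_block p q m $$ (r, j * n + e) * eig_block q s m' $$ (j * n + e, c))"
    by (rule sum_blocks)
  also have "\<dots> = (\<Sum>j<q. \<Sum>e<n. \<Sum>a<n. U $$ (r mod n, a) * m a ?t j *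
      (V $$ (a, e) * (\<Sum>b<n. U $$ (e, b) * (m' b j ?u * V $$ (b, c mod n)))))"
    using rc by (intro sum.cong refl) (simp add: eig_block_index block_index_less sum_distrib_right mult.assoc)
  also have "\<dots> = (\<Sum>j<q. \<Sum>a<n. U $$ (r mod n, a) * m a ?t j *
      (\<Sum>e<n. V $$ (a, e) * (\<Sum>b<n. U $$ (e, b) * (m' b j ?u * V $$ (b, c mod n)))))"
    by (rule sum.cong[OF refl], subst sum.swap) (simp add: sum_distrib_left)
  also have "\<dots> = (\<Sum>j<q. \<Sum>a<n. U $$ (r mod n, a) * m a ?t j * (m' a j ?u * V $$ (a, c mod n)))"
    by (intro sum.cong refl) (simp add: contract)
  also have "\<dots> = (\<Sum>a<n. \<Sum>j<q. U $$ (r mod n, a) * m a ?t j * (m' a j ?u * V $$ (a, c mod n)))"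
    by (rule sum.swap)
  also have "\<dots> = eig_block p s (\<lambda>a t u. \<Sum>j<q. m a t j * m' a j u) $$ (r, c)"
    using rc by (simp add: eig_block_index sum_distrib_left sum_distrib_right mult.assoc)
  finally show "(eig_block p q m * eig_block q s m') $$ (r, c) = eig_block p s (\<lambda>a t u. \<Sum>j<q. m a t j * m' a j u) $$ (r, c)" .
qed auto

lemma eig_block_one: "eig_block p p (\<lambda>a t s. if t = s then 1 else 0) = 1\<^sub>m (p * n)"
proof (rule eq_matI)
  fix r c assume "r < dim_row (1\<^sub>m (p * n) :: complex mat)" "c < dim_col (1\<^sub>m (p * n) :: complex mat)"
  hence rc: "r < p * n" "c < p * n" by auto
  have "r div n = c div n \<and> r mod n = c mod n \<longleftrightarrow> r = c"
    by (metis div_mult_mod_eq)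
  thus "eig_block p p (\<lambda>a t s. if t = s then 1 else 0) $$ (r, c) = 1\<^sub>m (p * n) $$ (r, c)"
    using rc UV_entry[of "r mod n" "c mod n"] by (auto simp: eig_block_index div_mod_less)
qed auto

lemma eig_block_zero: "eig_block p q (\<lambda>a t s. 0) = 0\<^sub>m (p * n) (q * n)"
  by (intro eq_matI) (auto simp: eig_block_index)

lemma eig_block_uminus: "- eig_block p q m = eig_block p q (\<lambda>a t s. - m a t s)"
  by (intro eq_matI) (auto simp: eig_block_index sum_negf)

lemma eig_block_minus: "eig_block p q m - eig_block p q m' = eig_block p q (\<lambda>a t s. m a t s - m' a t s)"
  by (intro eq_matI) (auto simp: eig_block_index sum_subtractf[symmetric] algebra_simps)

lemma eig_block_append_rows:
  "eig_block p q m @\<^sub>r eig_block p' q m' = eig_block (p + p') q (\<lambda>a t s. if t < p then m a t s else m' a (t - p) s)"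
proof (rule eq_matI)
  let ?M = "eig_block (p + p') q (\<lambda>a t s. if t < p then m a t s else m' a (t - p) s)"
  fix r c assume "r < dim_row ?M" "c < dim_col ?M"
  hence rc: "r < (p + p') * n" "c < q * n" by auto
  show "(eig_block p q m @\<^sub>r eig_block p' q m') $$ (r, c) = ?M $$ (r, c)"
  proof (cases "r < p * n")
    case True
    thus ?thesis using rc by (simp add: append_rows_def eig_block_index div_mod_less)
  next
    case False
    then obtain r' where r': "r = r' + p * n" by (metis add.commute le_Suc_ex not_less)
    hence "r' < p' * n" using rc by (simp add: distrib_right)
    moreover have "r div n = r' div n + p" "r mod n = r' mod n" using n_pos r' by simp_all
    ultimately show ?thesis using rc r' by (simp add: append_rows_def eig_block_index)
  qed
qed (auto simp: append_rows_def distrib_right)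

lemma eig_block_append_cols:
  "eig_block p q m @\<^sub>c eig_block p q' m' = eig_block p (q + q') (\<lambda>a t s. if s < q then m a t s else m' a t (s - q))"
proof (rule eq_matI)
  let ?M = "eig_block p (q + q') (\<lambda>a t s. if s < q then m a t s else m' a t (s - q))"
  fix r c assume "r < dim_row ?M" "c < dim_col ?M"
  hence rc: "r < p * n" "c < (q + q') * n" by auto
  show "(eig_block p q m @\<^sub>c eig_block p q' m') $$ (r, c) = ?M $$ (r, c)"
  proof (cases "c < q * n")
    case True
    thus ?thesis using rc by (simp add: append_cols_def eig_block_index div_mod_less)
  next
    case False
    then obtain c' where c': "c = c' + q * n" by (metis add.commute le_Suc_ex not_less)
    hence "c' < q' * n" using rc by (simp add: distrib_right)
    moreover have "c div n = c' div n + q" "c mod n = c' mod n" using n_pos c' by simp_all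
    ultimately show ?thesis using rc c' by (simp add: append_cols_def eig_block_index)
  qed
qed (auto simp: append_cols_def distrib_right)

lemma mat_inv_eig_block:
  assumes "\<And>a t u. a < n \<Longrightarrow> t < p \<Longrightarrow> u < p \<Longrightarrow> (\<Sum>s<p. m a t s * w a s u) = (if t = u then 1 else 0)"
  shows "mat_inv (eig_block p p m) = eig_block p p w"
  using assms by (intro mat_inv_eqI[OF eig_block_carrier eig_block_carrier]) 
    (auto simp: eig_block_mult simp flip: eig_block_one intro!: eig_block_cong)

text \<open>Only whole time points are selected, so the choice of rows and columns acts on the
  scalar arrays alone.\<close>

lemma eig_block_submatrix:
  assumes f: "strict_mono f" "range f = S" "\<And>i. f i < N \<longleftrightarrow> i < p"
    and g: "strict_mono g" "range g = T" "\<And>i. g i < M \<longleftrightarrow> i < q"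
  shows "submatrix (eig_block N M m) {r. r div n \<in> S} {r. r div n \<in> T} = eig_block p q (\<lambda>a t s. m a (f t) (g s))"
proof -
  let ?f = "\<lambda>r. f (r div n) * n + r mod n" and ?g = "\<lambda>r. g (r div n) * n + r mod n"
  note F = block_enum[OF n_pos f(1,2)] and G = block_enum[OF n_pos g(1,2)]
  have "submatrix (eig_block N M m) {r. r div n \<in> S} {r. r div n \<in> T} =
      mat (p * n) (q * n) (\<lambda>(i, j). eig_block N M m $$ (?f i, ?g j))"
    using F(1,2) F(3)[OF f(3)] G(1,2) G(3)[OF g(3)] by (intro submatrix_eqI) simp_all
  also have "\<dots> = eig_block p q (\<lambda>a t s. m a (f t) (g s))"
    using F(3)[OF f(3)] G(3)[OF g(3)] n_pos by (intro eq_matI) (auto simp: eig_block_index)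
  finally show ?thesis .
qed

end

lemma block_diag_mult_one:
  assumes X: "X \<in> carrier_mat n n" and Y: "Y \<in> carrier_mat n n" and XY: "X * Y = 1\<^sub>m n"
  shows "block_diag n N X * block_diag n N Y = 1\<^sub>m (N * n)"
proof (rule eq_matI)
  fix r c assume "r < dim_row (1\<^sub>m (N * n) :: complex mat)" "c < dim_col (1\<^sub>m (N * n) :: complex mat)"
  hence rc: "r < N * n" "c < N * n" by auto
  note dm = div_mod_less[OF rc(1)] div_mod_less[OF rc(2)]
  have cY: "col (block_diag n N Y) c \<in> carrier_vec (N * n)"
    by (rule carrier_vecI) (simp add: block_diag_def)
  have "(block_diag n N X * block_diag n N Y) $$ (r, c) = (block_diag n N X *\<^sub>v col (block_diag n N Y) c) $ r"
    using rc by (simp add: block_diag_def)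
  also have "\<dots> = (\<Sum>b<n. X $$ (r mod n, b) * col (block_diag n N Y) c $ (r div n * n + b))"
    by (rule block_diag_mult_vec[OF cY rc(1)])
  also have "\<dots> = (\<Sum>b<n. if r div n = c div n then X $$ (r mod n, b) * Y $$ (b, c mod n) else 0)"
    using rc dm by (intro sum.cong refl) (auto simp: block_diag_def block_index_less)
  also have "\<dots> = (if r div n = c div n then (X * Y) $$ (r mod n, c mod n) else 0)"
    using X Y dm by (auto simp: scalar_prod_def atLeast0LessThan)
  also have "\<dots> = 1\<^sub>m (N * n) $$ (r, c)"
    using rc dm unfolding XY by (auto simp: one_mat_def) (metis div_mult_mod_eq)
  finally show "(block_diag n N X * block_diag n N Y) $$ (r, c) = 1\<^sub>m (N * n) $$ (r, c)" .
qed (auto simp: block_diag_def)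

text \<open>The eigenvector shows that the norm of \<open>X ^\<^sub>m p\<close> is at least
  \<open>cmod \<mu> ^ p\<close>.\<close>

lemma cmod_eigenvalue_less_1:
  assumes X: "X \<in> carrier_mat n n" and st: "stable_mat X" and ev: "eigenvector X v \<mu>"
  shows "cmod \<mu> < 1"
proof (rule ccontr)
  assume ge: "\<not> cmod \<mu> < 1"
  from st obtain p where p: "l2_opnorm (X ^\<^sub>m p) < 1" by (auto simp: stable_mat_def)
  define Y where "Y = X ^\<^sub>m p"
  have Y: "Y \<in> carrier_mat n n" using X by (simp add: Y_def)
  have v: "v \<in> carrier_vec n" "v \<noteq> 0\<^sub>v n" using ev X by (auto simp: eigenvector_def)
  have Yv: "Y *\<^sub>v v = \<mu> ^ p \<cdot>\<^sub>v v" unfolding Y_def by (rule eigenvector_pow[OF X ev])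
  define S where "S = {vnorm_wrt (1\<^sub>m n) (Y *\<^sub>v w) / vnorm_wrt (1\<^sub>m n) w | w. w \<in> carrier_vec n \<and> w \<noteq> 0\<^sub>v n}"
  have S: "l2_opnorm Y = Sup S"
    using Y by (simp add: l2_opnorm_def opnorm_wrt_def S_def)
  \<comment> \<open>Without boundedness \<open>Sup S\<close> would say nothing about individual
    quotients.\<close>
  have "bdd_above S"
  proof (rule bdd_aboveI)
    fix s assume "s \<in> S"
    then obtain w where w: "w \<in> carrier_vec n" "s = vnorm_wrt (1\<^sub>m n) (Y *\<^sub>v w) / vnorm_wrt (1\<^sub>m n) w"
      by (auto simp: S_def)
    have "vnorm_wrt (1\<^sub>m n) (Y *\<^sub>v w) = l2norm n (\<lambda>i. (Y *\<^sub>v w) $ i)"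
      using Y w by (intro vnorm_wrt_one) auto
    also have "\<dots> = l2norm n (arr_apply n (\<lambda>i j. Y $$ (i, j)) (\<lambda>j. w $ j))"
      using Y w by (intro l2norm_cong) (auto simp: arr_apply_def scalar_prod_def atLeast0LessThan)
    also have "\<dots> \<le> arr_norm n n (\<lambda>i j. Y $$ (i, j)) * l2norm n (\<lambda>j. w $ j)"
      by (rule l2norm_arr_apply_le_arr_norm)
    \<comment> \<open>Division by a zero norm would give the quotient 0, which
      \<open>arr_norm_nonneg\<close> covers.\<close>
    finally show "s \<le> arr_norm n n (\<lambda>i j. Y $$ (i, j))"
      using w arr_norm_nonneg[of n n "\<lambda>i j. Y $$ (i, j)"] order_le_imp_less_or_eq[OF l2norm_nonneg[of n "\<lambda>j. w $ j"]]
      by (auto simp: vnorm_wrt_one divide_le_eq)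
  qed
  moreover have "vnorm_wrt (1\<^sub>m n) (Y *\<^sub>v v) / vnorm_wrt (1\<^sub>m n) v \<in> S"
    using v by (auto simp: S_def)
  ultimately have "vnorm_wrt (1\<^sub>m n) (Y *\<^sub>v v) / vnorm_wrt (1\<^sub>m n) v \<le> Sup S"
    by (intro cSup_upper)
  moreover have "vnorm_wrt (1\<^sub>m n) (Y *\<^sub>v v) = cmod (\<mu> ^ p) * vnorm_wrt (1\<^sub>m n) v"
  proof -
    have "l2norm n (\<lambda>i. (\<mu> ^ p \<cdot>\<^sub>v v) $ i) = l2norm n (\<lambda>i. \<mu> ^ p * v $ i)"
      using v by (intro l2norm_cong) auto
    thus ?thesis using v by (simp add: Yv vnorm_wrt_one l2norm_scale)
  qed
  moreover have "vnorm_wrt (1\<^sub>m n) v \<noteq> 0"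
    using v by (auto simp: vnorm_wrt_one l2norm_eq_0_iff)
  ultimately have "cmod \<mu> ^ p < 1" using p S by (simp add: Y_def norm_power)
  moreover have "1 \<le> cmod \<mu> ^ p" using ge by (intro one_le_power) simp
  ultimately show False by simp
qed

definition bidiag :: "complex \<Rightarrow> nat \<Rightarrow> nat \<Rightarrow> complex" where
  "bidiag x t s = (if t = s then 1 else if t = Suc s then - x else 0)"

section \<open>Weighted operator norms as maxima over eigenvectors\<close>

context eigenbasis
begin

text \<open>The coefficient of \<open>v\<close> at time \<open>t\<close> along the eigenvector
  \<open>col U a\<close>.\<close>

definition coord :: "complex vec \<Rightarrow> nat \<Rightarrow> nat \<Rightarrow> complex" where
  "coord v a t = (\<Sum>b<n. V $$ (a, b) * v $ (t * n + b))"

text \<open>In the weighted norm the eigencomponents are mutually orthogonal, so their squared norms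
  add up.\<close>

lemma vnorm_block_diag:
  assumes v: "v \<in> carrier_vec (N * n)"
  shows "vnorm_wrt (mat_inv (block_diag n N U * mat_adjoint (block_diag n N U))) v = sqrt (\<Sum>a<n. (l2norm N (coord v a))\<^sup>2)"
proof -
  have "vnorm_wrt (mat_inv (block_diag n N U * mat_adjoint (block_diag n N U))) v = l2norm (N * n) (\<lambda>r. (block_diag n N V *\<^sub>v v) $ r)"
    by (rule vnorm_wrt_gram[OF block_diag_carrier block_diag_carrier block_diag_mult_one[OF V U VU] v])
  also have "\<dots> = l2norm (N * n) (\<lambda>r. coord v (r mod n) (r div n))"
    by (intro l2norm_cong) (simp add: block_diag_mult_vec[OF v] coord_def)
  also have "\<dots> = sqrt (\<Sum>r<N * n. (cmod (coord v (r mod n) (r div n)))\<^sup>2)"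
    by (simp flip: l2norm_power2)
  also have "(\<Sum>r<N * n. (cmod (coord v (r mod n) (r div n)))\<^sup>2) = (\<Sum>t<N. \<Sum>a<n. (cmod (coord v a t))\<^sup>2)"
    by (rule sum_div_mod)
  also have "\<dots> = (\<Sum>a<n. (l2norm N (coord v a))\<^sup>2)"
    unfolding l2norm_power2 by (rule sum.swap)
  finally show ?thesis .
qed

lemma coord_eig_block:
  assumes v: "v \<in> carrier_vec (q * n)" and a: "a < n" and t: "t < p"
  shows "coord (eig_block p q m *\<^sub>v v) a t = arr_apply q (m a) (coord v a) t"
proof -
  have "(eig_block p q m *\<^sub>v v) $ (t * n + e) = (\<Sum>b<n. U $$ (e, b) * arr_apply q (m b) (coord v b) t)" if e: "e < n" for e
  proof -
    have "(eig_block p q m *\<^sub>v v) $ (t * n + e) = (\<Sum>c<q * n. eig_block p q m $$ (t * n + e, c) * v $ c)"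
      using v block_index_less[OF t e] by (simp add: scalar_prod_def atLeast0LessThan)
    also have "\<dots> = (\<Sum>s<q. \<Sum>c<n. \<Sum>b<n. U $$ (e, b) * (m b t s * (V $$ (b, c) * v $ (s * n + c))))"
      unfolding sum_blocks using e block_index_less[OF t e]
      by (intro sum.cong refl) (simp add: eig_block_index block_index_less sum_distrib_right mult.assoc)
    also have "\<dots> = (\<Sum>s<q. \<Sum>b<n. U $$ (e, b) * (m b t s * coord v b s))"
      by (rule sum.cong[OF refl], subst sum.swap) (simp add: coord_def sum_distrib_left)
    also have "\<dots> = (\<Sum>b<n. U $$ (e, b) * arr_apply q (m b) (coord v b) t)"
      by (subst sum.swap) (simp add: arr_apply_def sum_distrib_left)
    finally show ?thesis .
  qed
  hence "coord (eig_block p q m *\<^sub>v v) a t = (\<Sum>e<n. V $$ (a, e) * (\<Sum>b<n. U $$ (e, b) * arr_apply q (m b) (coord v b) t))"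
    by (simp add: coord_def)
  also have "\<dots> = arr_apply q (m a) (coord v a) t" by (rule contract[OF a])
  finally show ?thesis .
qed

text \<open>Supplies test vectors concentrated on a single eigenvector.\<close>

lemma ex_coord:
  obtains v where "v \<in> carrier_vec (N * n)" "\<And>a t. a < n \<Longrightarrow> t < N \<Longrightarrow> coord v a t = z a t"
proof
  define v where "v = vec (N * n) (\<lambda>r. \<Sum>b<n. U $$ (r mod n, b) * z b (r div n))"
  show "v \<in> carrier_vec (N * n)" by (simp add: v_def)
  fix a t assume at: "a < n" "t < N"
  have "coord v a t = (\<Sum>e<n. V $$ (a, e) * (\<Sum>b<n. U $$ (e, b) * z b t))"
    unfolding coord_def using at by (intro sum.cong refl) (simp add: v_def block_index_less)
  also have "\<dots> = z a t" by (rule contract[OF at(1)])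
  finally show "coord v a t = z a t" .
qed

text \<open>The operator acts on orthogonal components separately: bounding each component gives
  \<le>, and vectors supported on one component give \<ge>.\<close>

lemma UU_opnorm_eig_block:
  fixes k Nc :: nat
  defines "N \<equiv> num_points k Nc"
  shows "UU_opnorm k Nc U (eig_block N N m) = (MAX a\<in>{..<n}. arr_norm N N (m a))"
proof -
  define W where "W = mat_inv (block_diag n N U * mat_adjoint (block_diag n N U))"
  define L where "L = (MAX a\<in>{..<n}. arr_norm N N (m a))"
  define S where "S = {vnorm_wrt W (eig_block N N m *\<^sub>v v) / vnorm_wrt W v | v. v \<in> carrier_vec (N * n) \<and> v \<noteq> 0\<^sub>v (N * n)}"
  have Sup: "UU_opnorm k Nc U (eig_block N N m) = Sup S"
    using diag_block_mat_replicate[OF U n_pos, of "num_points k Nc"]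
    by (simp add: UU_opnorm_def opnorm_wrt_def S_def U_tilde_def W_def N_def)
  have L: "arr_norm N N (m a) \<le> L" if "a < n" for a
    unfolding L_def using that by (intro Max_ge) auto
  have L0: "0 \<le> L" using L[OF n_pos] arr_norm_nonneg order_trans by blast
  have norm: "vnorm_wrt W v = sqrt (\<Sum>a<n. (l2norm N (coord v a))\<^sup>2)" if "v \<in> carrier_vec (N * n)" for v
    unfolding W_def by (rule vnorm_block_diag[OF that])
  have norm_eig_block: "vnorm_wrt W (eig_block N N m *\<^sub>v v) = sqrt (\<Sum>a<n. (l2norm N (arr_apply N (m a) (coord v a)))\<^sup>2)"
    if v: "v \<in> carrier_vec (N * n)" for v
  proof -
    have "eig_block N N m *\<^sub>v v \<in> carrier_vec (N * n)" by (rule mult_mat_vec_carrier[OF eig_block_carrier v])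
    hence "vnorm_wrt W (eig_block N N m *\<^sub>v v) = sqrt (\<Sum>a<n. (l2norm N (coord (eig_block N N m *\<^sub>v v) a))\<^sup>2)"
      by (rule norm)
    also have "(\<Sum>a<n. (l2norm N (coord (eig_block N N m *\<^sub>v v) a))\<^sup>2) = (\<Sum>a<n. (l2norm N (arr_apply N (m a) (coord v a)))\<^sup>2)"
      by (intro sum.cong refl arg_cong[of _ _ "\<lambda>x. x\<^sup>2"] l2norm_cong coord_eig_block[OF v]) auto
    finally show ?thesis .
  qed
  have upper: "s \<le> L" if "s \<in> S" for s
  proof -
    from that obtain v where v: "v \<in> carrier_vec (N * n)" "s = vnorm_wrt W (eig_block N N m *\<^sub>v v) / vnorm_wrt W v"
      by (auto simp: S_def)
    have "l2norm N (arr_apply N (m a) (coord v a)) \<le> L * l2norm N (coord v a)" if "a < n" for a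
      using l2norm_arr_apply_le_arr_norm[of N N "m a" "coord v a"] mult_right_mono[OF L[OF that] l2norm_nonneg[of N "coord v a"]]
      by linarith
    hence "(\<Sum>a<n. (l2norm N (arr_apply N (m a) (coord v a)))\<^sup>2) \<le> (\<Sum>a<n. (L * l2norm N (coord v a))\<^sup>2)"
      by (intro sum_mono power_mono) auto
    also have "\<dots> = L\<^sup>2 * (\<Sum>a<n. (l2norm N (coord v a))\<^sup>2)"
      by (simp add: power_mult_distrib sum_distrib_left)
    finally have "vnorm_wrt W (eig_block N N m *\<^sub>v v) \<le> sqrt (L\<^sup>2 * (\<Sum>a<n. (l2norm N (coord v a))\<^sup>2))"
      unfolding norm_eig_block[OF v(1)] by (rule real_sqrt_le_mono)
    also have "\<dots> = L * vnorm_wrt W v"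
      unfolding norm[OF v(1)] using L0 by (simp add: real_sqrt_mult)
    finally have "vnorm_wrt W (eig_block N N m *\<^sub>v v) \<le> L * vnorm_wrt W v" .
    moreover have "0 \<le> vnorm_wrt W v" unfolding norm[OF v(1)] by (simp add: sum_nonneg)
    ultimately show "s \<le> L" using L0 v(2)
      by (cases "vnorm_wrt W v = 0") (auto simp: divide_le_eq)
  qed
  have lower: "arr_norm N N (m a) \<le> Sup S" if a: "a < n" for a
  proof -
    have ratio: "l2norm N (arr_apply N (m a) x) \<le> Sup S * l2norm N x \<and> 0 \<le> Sup S" if x: "l2norm N x \<noteq> 0" for x
    proof -
      obtain v where v: "v \<in> carrier_vec (N * n)"
        and z: "\<And>b t. b < n \<Longrightarrow> t < N \<Longrightarrow> coord v b t = (if b = a then x t else 0)"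
        using ex_coord[where z = "\<lambda>b t. if b = a then x t else 0"] by blast
      have "v \<noteq> 0\<^sub>v (N * n)"
      proof
        assume v0: "v = 0\<^sub>v (N * n)"
        have "x t = 0" if "t < N" for t
          using z[OF a that] that by (simp add: v0 coord_def block_index_less)
        thus False using x by (simp add: l2norm_eq_0_iff)
      qed
      hence mem: "vnorm_wrt W (eig_block N N m *\<^sub>v v) / vnorm_wrt W v \<in> S"
        using v by (auto simp: S_def)
      have 1: "(\<Sum>b<n. (l2norm N (coord v b))\<^sup>2) = (\<Sum>b<n. if b = a then (l2norm N x)\<^sup>2 else 0)"
      proof (intro sum.cong refl)
        fix b assume "b \<in> {..<n}"
        hence "l2norm N (coord v b) = l2norm N (\<lambda>t. if b = a then x t else 0)"
          by (intro l2norm_cong z) auto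
        thus "(l2norm N (coord v b))\<^sup>2 = (if b = a then (l2norm N x)\<^sup>2 else 0)" by simp
      qed
      have 2: "(\<Sum>b<n. (l2norm N (arr_apply N (m b) (coord v b)))\<^sup>2) = (\<Sum>b<n. if b = a then (l2norm N (arr_apply N (m a) x))\<^sup>2 else 0)"
      proof (intro sum.cong refl)
        fix b assume "b \<in> {..<n}"
        hence "l2norm N (arr_apply N (m b) (coord v b)) = l2norm N (arr_apply N (m b) (\<lambda>t. if b = a then x t else 0))"
          by (intro l2norm_cong) (auto simp: arr_apply_def z)
        thus "(l2norm N (arr_apply N (m b) (coord v b)))\<^sup>2 = (if b = a then (l2norm N (arr_apply N (m a) x))\<^sup>2 else 0)"
          by (cases "b = a") simp_all
      qed
      have "vnorm_wrt W (eig_block N N m *\<^sub>v v) / vnorm_wrt W v = l2norm N (arr_apply N (m a) x) / l2norm N x"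
        unfolding norm[OF v] norm_eig_block[OF v] 1 2 using a by simp
      hence le: "l2norm N (arr_apply N (m a) x) / l2norm N x \<le> Sup S"
        using cSup_upper[OF mem bdd_aboveI[of S L]] upper by simp
      have pos: "l2norm N x > 0" using x l2norm_nonneg[of N x] by linarith
      hence "0 \<le> l2norm N (arr_apply N (m a) x) / l2norm N x" by simp
      hence "0 \<le> Sup S" using le by linarith
      thus ?thesis using le pos by (simp add: pos_divide_le_eq)
    qed
    \<comment> \<open>Any array of nonzero norm yields this through \<open>ratio\<close>; one exists
      because \<open>num_points\<close> is at least 1.\<close>
    have S0: "0 \<le> Sup S"
    proof -
      have "l2norm N (\<lambda>_. 1) \<noteq> 0" by (auto simp: l2norm_eq_0_iff N_def num_points_def)
      from ratio[OF this] show ?thesis by simp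
    qed
    show ?thesis
    proof (rule arr_norm_le[OF _ S0])
      fix x
      show "l2norm N (arr_apply N (m a) x) \<le> Sup S * l2norm N x"
      proof (cases "l2norm N x = 0")
        case True
        thus ?thesis using l2norm_arr_apply_le_arr_norm[of N N "m a" x] by simp
      qed (simp add: ratio)
    qed
  qed
  have "S \<noteq> {}"
  proof -
    have "unit_vec (N * n) 0 \<noteq> (0\<^sub>v (N * n) :: complex vec)"
      using n_pos arg_cong[of "unit_vec (N * n) 0" "0\<^sub>v (N * n) :: complex vec" "\<lambda>v. v $ 0"]
      by (auto simp: N_def num_points_def)
    thus ?thesis unfolding S_def by (auto intro!: exI[of _ "unit_vec (N * n) 0"])
  qed
  hence "Sup S \<le> L" using upper by (rule cSup_least)
  moreover have "L \<le> Sup S"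
    unfolding L_def using lower n_pos by (subst Max_le_iff) auto
  ultimately show ?thesis using Sup L_def by simp
qed

text \<open>Entrywise form of \<open>X = (X * U) * V\<close>, where \<open>X * U\<close> scales the
  columns of \<open>U\<close> by the eigenvalues.\<close>

lemma eigen_entry:
  assumes X: "X \<in> carrier_mat n n" and ev: "\<And>i. i < n \<Longrightarrow> eigenvector X (col U i) (x i)"
    and bc: "b < n" "c < n"
  shows "X $$ (b, c) = (\<Sum>a<n. U $$ (b, a) * x a * V $$ (a, c))"
proof -
  have XU: "(X * U) $$ (b, a) = U $$ (b, a) * x a" if "a < n" for a
  proof -
    have "(X * U) $$ (b, a) = (X *\<^sub>v col U a) $ b" using X U bc that by simp
    also have "X *\<^sub>v col U a = x a \<cdot>\<^sub>v col U a" using ev[OF that] by (simp add: eigenvector_def)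
    finally show ?thesis using U bc that by simp
  qed
  define Y where "Y = X * U"
  have Y: "Y \<in> carrier_mat n n" using X U by (simp add: Y_def)
  have "X = Y * V" using X U V UV unfolding Y_def by (simp add: assoc_mult_mat[OF X U V])
  hence "X $$ (b, c) = (Y * V) $$ (b, c)" by simp
  also have "\<dots> = (\<Sum>a<n. Y $$ (b, a) * V $$ (a, c))"
    using Y V bc by (simp add: scalar_prod_def atLeast0LessThan)
  finally show ?thesis by (simp add: XU Y_def)
qed

lemma block_bidiag_eig_block:
  assumes X: "X \<in> carrier_mat n n" and ev: "\<And>i. i < n \<Longrightarrow> eigenvector X (col U i) (x i)"
  shows "block_bidiag n p X = eig_block p p (\<lambda>a. bidiag (x a))"
proof (rule eq_matI)
  fix r c assume "r < dim_row (eig_block p p (\<lambda>a. bidiag (x a)))" "c < dim_col (eig_block p p (\<lambda>a. bidiag (x a)))"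
  hence rc: "r < p * n" "c < p * n" by auto
  note dm = div_mod_less[OF rc(1)] div_mod_less[OF rc(2)]
  show "block_bidiag n p X $$ (r, c) = eig_block p p (\<lambda>a. bidiag (x a)) $$ (r, c)"
    using rc dm X eigen_entry[OF X ev dm(2,4)] UV_entry[OF dm(2,4)]
    by (auto simp: block_bidiag_def eig_block_index bidiag_def sum_negf[symmetric] one_mat_def)
qed (auto simp: block_bidiag_def)

end

subsection \<open>The two-level operators in the eigenbasis\<close>

lemma sum_bidiag_left:
  assumes "i < N"
  shows "(\<Sum>l<N. bidiag c i l * x l) = x i - c * (if i = 0 then 0 else x (i - 1))"
proof -
  \<comment> \<open>For \<open>i = 0\<close> the truncated \<open>i - 1\<close> collides with
    \<open>i\<close>; the inner guard removes this spurious term.\<close>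
  have "(\<Sum>l<N. bidiag c i l * x l) =
      (\<Sum>l<N. (if l = i then x l else 0) + (if l = i - 1 then (if i = 0 then 0 else - c * x l) else 0))"
    by (intro sum.cong) (auto simp: bidiag_def)
  also have "\<dots> = x i + (if i = 0 then 0 else - c * x (i - 1))"
    using assms by (simp add: sum.distrib less_imp_diff_less)
  finally show ?thesis by auto
qed

lemma sum_bidiag_right:
  assumes "j < N"
  shows "(\<Sum>l<N. x l * bidiag c l j) = x j - c * (if Suc j < N then x (Suc j) else 0)"
proof -
  have "(\<Sum>l<N. x l * bidiag c l j) =
      (\<Sum>l<N. (if l = j then x l else 0) + (if l = Suc j then - c * x l else 0))"
    by (intro sum.cong) (auto simp: bidiag_def)
  also have "\<dots> = x j + (if Suc j < N then - c * x (Suc j) else 0)"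
    using assms by (simp add: sum.distrib)
  finally show ?thesis by auto
qed

text \<open>The time point of the \<open>t\<close>-th F-point for coarsening factor \<open>K + 1\<close>; working with \<open>K = k - 1\<close> and
  \<open>M = N\<^sub>c - 1\<close> from here on avoids truncated subtraction.\<close>

definition ftime :: "nat \<Rightarrow> nat \<Rightarrow> nat" where
  "ftime K t = (t div K) * Suc K + t mod K + 1"

text \<open>Division recovers the interval and the offset of an F-point. The offset is never 0,
  which separates F-points from C-points.\<close>

lemma ftime_div_mod:
  assumes "K > 0"
  shows "ftime K t div Suc K = t div K" "ftime K t mod Suc K = Suc (t mod K)"
proof -
  have "ftime K t = t div K * Suc K + Suc (t mod K)" by (simp add: ftime_def)
  moreover have "Suc (t mod K) < Suc K" using assms by simp
  ultimately show "ftime K t div Suc K = t div K" "ftime K t mod Suc K = Suc (t mod K)"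
    by (simp_all only: div_mult_self3 div_less mod_mult_self3 mod_less add_0_right)
qed

lemma ftime_enum:
  assumes K: "K > 0"
  shows "strict_mono (ftime K)" "range (ftime K) = {t. \<not> Suc K dvd t}"
    "ftime K t < M * Suc K + 1 \<longleftrightarrow> t < M * K"
proof -
  note dm = ftime_div_mod[OF K]
  show "strict_mono (ftime K)"
  proof (rule strict_monoI)
    fix s t :: nat assume st: "s < t"
    show "ftime K s < ftime K t"
    proof (cases "s div K = t div K")
      case True
      hence "s mod K < t mod K" using st by (metis add_less_cancel_left div_mult_mod_eq)
      thus ?thesis unfolding ftime_def True by linarith
    next
      case False
      hence "s div K < t div K" using st div_le_mono[of s t K] by linarith
      hence "ftime K s div Suc K < ftime K t div Suc K" by (simp only: dm)
      thus ?thesis by (meson div_le_mono leD leI)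
    qed
  qed
  show "range (ftime K) = {t. \<not> Suc K dvd t}"
  proof (intro equalityI subsetI)
    fix r assume "r \<in> range (ftime K)"
    then obtain t where "r = ftime K t" by auto
    thus "r \<in> {t. \<not> Suc K dvd t}" using dm(2)[of t] by (simp add: dvd_eq_mod_eq_0)
  next
    fix r assume "r \<in> {t. \<not> Suc K dvd t}"
    hence "r mod Suc K \<noteq> 0" by (simp add: dvd_eq_mod_eq_0)
    then obtain e where e: "r mod Suc K = Suc e" by (metis not0_implies_Suc)
    hence "e < K" using mod_less_divisor[of "Suc K" r] by simp
    hence "ftime K (r div Suc K * K + e) = r div Suc K * Suc K + r mod Suc K"
      using e by (simp add: ftime_def)
    hence "ftime K (r div Suc K * K + e) = r" by (simp only: div_mult_mod_eq)
    thus "r \<in> range (ftime K)" by (metis rangeI)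
  qed
  \<comment> \<open>The last time point is a C-point, so the final \<open>+ 1\<close> in the range
    admits no further F-point.\<close>
  have ne: "ftime K t \<noteq> M * Suc K" using dm(2)[of t] by (metis mod_mult_self2_is_0 nat.distinct(1))
  have "ftime K t < M * Suc K + 1 \<longleftrightarrow> ftime K t < M * Suc K" using ne by linarith
  also have "\<dots> \<longleftrightarrow> ftime K t div Suc K < M" by (rule div_less_iff_less_mult[symmetric]) simp
  also have "\<dots> \<longleftrightarrow> t < M * K" using K by (simp only: dm div_less_iff_less_mult)
  finally show "ftime K t < M * Suc K + 1 \<longleftrightarrow> t < M * K" .
qed

lemma ctime_enum:
  "strict_mono (\<lambda>j. j * Suc K)" "range (\<lambda>j. j * Suc K) = {t. Suc K dvd t}"
  "j * Suc K < M * Suc K + 1 \<longleftrightarrow> j < Suc M"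
proof -
  have "j * Suc K < M * Suc K + 1 \<longleftrightarrow> j * Suc K \<le> M * Suc K" by linarith
  also have "\<dots> \<longleftrightarrow> j < Suc M" by (simp only: mult_le_cancel2) auto
  finally show "j * Suc K < M * Suc K + 1 \<longleftrightarrow> j < Suc M" .
qed (auto simp: strict_mono_def dvd_def mult.commute simp del: mult_Suc mult_Suc_right)

text \<open>Consecutive F-indices are consecutive times only inside one interval. The predecessor of
  an F-point with \<open>t mod K = 0\<close> is a C-point, so the F-block decouples into
  intervals.\<close>

lemma bidiag_ff:
  assumes K: "K > 0"
  shows "bidiag c (ftime K t) (ftime K s) = (if s = t then 1 else if t = Suc s \<and> t mod K \<noteq> 0 then - c else 0)"
proof -
  note dm = ftime_div_mod[OF K]
  have "ftime K t = ftime K s \<longleftrightarrow> t = s"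
    using strict_mono_eq[OF ftime_enum(1)[OF K]] by simp
  moreover have "ftime K t = Suc (ftime K s) \<longleftrightarrow> t = Suc s \<and> t mod K \<noteq> 0"
  proof
    assume a: "ftime K t = Suc (ftime K s)"
    have m: "Suc (s mod K) \<noteq> K"
    proof
      assume "Suc (s mod K) = K"
      hence "ftime K t mod Suc K = 0" using dm(2)[of s] unfolding a by (simp add: mod_Suc)
      thus False using dm(2)[of t] by simp
    qed
    hence "ftime K t mod Suc K = Suc (Suc (s mod K))" "ftime K t div Suc K = s div K"
      unfolding a using dm[of s] by (simp_all add: mod_Suc div_Suc)
    hence 1: "t mod K = Suc (s mod K)" "t div K = s div K" using dm[of t] by simp_all
    hence "t = Suc s" by (metis add_Suc_right div_mult_mod_eq)
    thus "t = Suc s \<and> t mod K \<noteq> 0" using 1 by simp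
  next
    assume "t = Suc s \<and> t mod K \<noteq> 0"
    thus "ftime K t = Suc (ftime K s)"
      by (auto simp: ftime_def mod_Suc div_Suc split: if_splits)
  qed
  ultimately show ?thesis by (auto simp: bidiag_def)
qed

text \<open>Only the first F-point of interval \<open>j\<close> directly follows the C-point
  \<open>j\<close>.\<close>

lemma bidiag_fc:
  assumes K: "K > 0"
  shows "bidiag c (ftime K s) (j * Suc K) = (if s = j * K then - c else 0)"
proof -
  note dm = ftime_div_mod[OF K]
  have "ftime K s \<noteq> j * Suc K" using dm(2)[of s] by (metis mod_mult_self2_is_0 nat.distinct(1))
  moreover have "ftime K s = Suc (j * Suc K) \<longleftrightarrow> s = j * K"
  proof
    assume a: "ftime K s = Suc (j * Suc K)"
    have "Suc (j * Suc K) div Suc K = j" "Suc (j * Suc K) mod Suc K = 1"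
      using K by (simp_all only: div_Suc mod_Suc, simp_all del: mult_Suc_right)
    hence "s div K = j" "s mod K = 0" using dm[of s] unfolding a by simp_all
    thus "s = j * K" by (metis add_0_right div_mult_mod_eq)
  qed (use K in \<open>simp add: ftime_def\<close>)
  ultimately show ?thesis by (simp only: bidiag_def if_False)
qed

text \<open>Only the last F-point of the preceding interval directly precedes the C-point
  \<open>j\<close>. The form \<open>Suc s = j * K\<close> is false for \<open>j = 0\<close>, as it
  must be.\<close>

lemma bidiag_cf:
  assumes K: "K > 0"
  shows "bidiag c (j * Suc K) (ftime K s) = (if Suc s = j * K then - c else 0)"
proof -
  note dm = ftime_div_mod[OF K]
  have "j * Suc K \<noteq> ftime K s" using dm(2)[of s] by (metis mod_mult_self2_is_0 nat.distinct(1))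
  moreover have "j * Suc K = Suc (ftime K s) \<longleftrightarrow> Suc s = j * K"
  proof
    assume a: "j * Suc K = Suc (ftime K s)"
    have "Suc (ftime K s) mod Suc K = 0" by (simp only: a[symmetric] mod_mult_self2_is_0)
    hence m: "Suc (s mod K) = K" using dm(2)[of s] by (simp add: mod_Suc split: if_splits)
    have "j = Suc (ftime K s) div Suc K" by (simp only: a[symmetric] nonzero_mult_div_cancel_right nat.distinct not_False_eq_True)
    hence "j = Suc (s div K)" using dm[of s] m by (simp add: div_Suc mod_Suc)
    moreover have "Suc s = s div K * K + K" using m by (metis add_Suc_right div_mult_mod_eq)
    ultimately show "Suc s = j * K" by (metis add.commute mult_Suc)
  next
    assume a: "Suc s = j * K"
    have "Suc (s mod K) = K" using a K by (metis mod_Suc mod_mult_self2_is_0 nat.distinct(1))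
    moreover have "Suc (s div K) = j" using a K calculation
      by (metis div_Suc mod_mult_self2_is_0 nonzero_mult_div_cancel_right not_gr_zero mod_Suc)
    ultimately have "Suc (s mod K) = K" "j * Suc K = s div K * Suc K + Suc K"
      by (auto simp: add.commute simp del: mult_Suc_right)
    thus "j * Suc K = Suc (ftime K s)" unfolding ftime_def by linarith
  qed
  ultimately show ?thesis by (simp only: bidiag_def if_False)
qed

text \<open>On each decoupled interval, the inverse of a bidiagonal Toeplitz matrix: powers of
  \<open>c\<close> below the diagonal.\<close>

definition ff_inverse :: "nat \<Rightarrow> complex \<Rightarrow> nat \<Rightarrow> nat \<Rightarrow> complex" where
  "ff_inverse K c s u = (if u \<le> s \<and> s div K = u div K then c ^ (s - u) else 0)"

lemma ff_inverse_inverse: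
  assumes K: "K > 0" and t: "t < N"
  shows "(\<Sum>s<N. bidiag c (ftime K t) (ftime K s) * ff_inverse K c s u) = (if t = u then 1 else 0)"
proof -
  have "(\<Sum>s<N. bidiag c (ftime K t) (ftime K s) * ff_inverse K c s u) =
      (\<Sum>s<N. (if s = t then ff_inverse K c s u else 0) +
        (if s = t - 1 then (if t mod K = 0 then 0 else - c * ff_inverse K c s u) else 0))"
  proof (intro sum.cong refl)
    fix s
    have "t mod K \<noteq> 0 \<Longrightarrow> t \<noteq> 0" by (intro notI) simp
    thus "bidiag c (ftime K t) (ftime K s) * ff_inverse K c s u = (if s = t then ff_inverse K c s u else 0) +
        (if s = t - 1 then (if t mod K = 0 then 0 else - c * ff_inverse K c s u) else 0)"
      unfolding bidiag_ff[OF K] by (cases "t mod K = 0") auto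
  qed
  also have "\<dots> = ff_inverse K c t u + (if t mod K = 0 then 0 else - c * ff_inverse K c (t - 1) u)"
    using t by (simp add: sum.distrib less_imp_diff_less)
  also have "\<dots> = (if t = u then 1 else 0)"
  proof (cases "t mod K = 0")
    \<comment> \<open>At the first F-point of an interval, row \<open>t\<close> of the inverse
      reduces to its diagonal entry.\<close>
    case True
    have "u \<le> t \<and> t div K = u div K \<longleftrightarrow> u = t"
    proof
      assume a: "u \<le> t \<and> t div K = u div K"
      have "t = t div K * K" using True by auto
      also have "\<dots> \<le> u" using a by simp
      finally show "u = t" using a by simp
    qed auto
    thus ?thesis using True by (auto simp: ff_inverse_def)
  next
    case False
    then obtain t' where t': "t = Suc t'" by (cases t) auto
    have d: "t' div K = t div K" using False unfolding t' by (auto simp: div_Suc mod_Suc split: if_splits)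
    show ?thesis using False d by (auto simp: ff_inverse_def t' Suc_diff_le le_Suc_eq)
  qed
  finally show ?thesis .
qed

text \<open>An F-point at offset \<open>t mod K + 1\<close> receives the value of its left C-point
  after that many fine steps. The sign cancels against the one in \<open>interp_op\<close>.\<close>

lemma ff_inverse_fc:
  assumes K: "K > 0" and t: "t < N"
  shows "(\<Sum>s<N. ff_inverse K c t s * bidiag c (ftime K s) (j * Suc K)) =
    - (if t div K = j then c ^ (t mod K + 1) else 0)"
proof -
  have "(\<Sum>s<N. ff_inverse K c t s * bidiag c (ftime K s) (j * Suc K)) = (\<Sum>s<N. if s = j * K then - c * ff_inverse K c t s else 0)"
    unfolding bidiag_fc[OF K] by (intro sum.cong) auto
  \<comment> \<open>The guard matters for a C-point that no F-point follows; there the claimed value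
    is 0 as well.\<close>
  also have "\<dots> = (if j * K < N then - c * ff_inverse K c t (j * K) else 0)" by simp
  also have "\<dots> = - (if t div K = j then c ^ (t mod K + 1) else 0)"
  proof (cases "t div K = j")
    case True
    have "j * K \<le> t" "t - j * K = t mod K" "j * K div K = j"
      using K by (simp_all flip: True add: minus_div_mult_eq_mod)
    thus ?thesis using True t by (simp add: ff_inverse_def)
  next
    case False
    thus ?thesis using K by (simp add: ff_inverse_def)
  qed
  finally show ?thesis .
qed

text \<open>An F-point at offset \<open>t mod K + 1\<close> is \<open>K - t mod K\<close> steps away
  from the next C-point.\<close>

lemma ff_inverse_cf:
  assumes K: "K > 0" and j: "j \<le> M" and t: "t < M * K"
  shows "(\<Sum>s<M * K. bidiag c (j * Suc K) (ftime K s) * ff_inverse K c s t) =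
    - (if j = t div K + 1 then c ^ (K - t mod K) else 0)"
proof (cases j)
  case 0
  thus ?thesis unfolding bidiag_cf[OF K] by simp
next
  case (Suc i)
  \<comment> \<open>The only nonzero summand belongs to the last F-point of interval
    \<open>i\<close>, with index \<open>i * K + (K - 1)\<close>.\<close>
  have p: "Suc (i * K + (K - 1)) = j * K" using K Suc by simp
  have "i * K + (K - 1) < j * K" using p by linarith
  also have "\<dots> \<le> M * K" using j by simp
  finally have l: "i * K + (K - 1) < M * K" .
  have "(\<Sum>s<M * K. bidiag c (j * Suc K) (ftime K s) * ff_inverse K c s t) =
      (\<Sum>s<M * K. if s = i * K + (K - 1) then - c * ff_inverse K c s t else 0)"
    unfolding bidiag_cf[OF K] by (intro sum.cong refl) (use p in auto)
  also have "\<dots> = - c * ff_inverse K c (i * K + (K - 1)) t" using l by simp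
  also have "\<dots> = - (if i = t div K then c ^ (K - t mod K) else 0)"
  proof -
    have "(i * K + (K - 1)) div K = i + (K - 1) div K" using K by (intro div_mult_self3) simp
    also have "(K - 1) div K = 0" using K by (intro div_less) simp
    finally have d: "(i * K + (K - 1)) div K = i" by simp
    show ?thesis
    proof (cases "i = t div K")
      case True
      have m: "t mod K \<le> K - 1" using mod_less_divisor[OF K, of t] by linarith
      have tt: "t = i * K + t mod K" using True by simp
      have "t \<le> i * K + (K - 1)" using m tt by linarith
      moreover have "(i * K + (K - 1)) div K = t div K" using d True by simp
      moreover have "Suc (i * K + (K - 1) - t) = K - t mod K" using m tt K by linarith
      ultimately have f: "ff_inverse K c (i * K + (K - 1)) t = c ^ (i * K + (K - 1) - t)"
        and e: "K - t mod K = Suc (i * K + (K - 1) - t)"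
        by (simp_all only: ff_inverse_def simp_thms if_True)
      show ?thesis using True unfolding f e by simp
    next
      case False
      thus ?thesis by (simp only: ff_inverse_def d) simp
    qed
  qed
  finally show ?thesis using Suc by simp
qed

section \<open>Coarse-grid correction for one eigenvector\<close>

lemma coarse_kernel_inverse:
  assumes "i < N"
  shows "(\<Sum>l<N. bidiag \<mu> i l * coarse_kernel \<mu> 0 l j) = (if i = j then 1 else 0)"
  unfolding sum_bidiag_left[OF assms] by (subst coarse_kernel_rec) auto

text \<open>With \<open>A = I - c S\<close> and \<open>B = I - \<mu> S\<close>, one has \<open>I -
  B\<^sup>-\<^sup>1 A = B\<^sup>-\<^sup>1 (B - A) = (c - \<mu>) B\<^sup>-\<^sup>1 S\<close>.\<close>

lemma err_core:
  assumes "i < N" "j < N"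
  shows "(if i = j then 1 else 0) - (\<Sum>l<N. coarse_kernel \<mu> 0 i l * bidiag c l j) = (c - \<mu>) * coarse_kernel \<mu> 1 i j"
proof -
  \<comment> \<open>In the last column both sides vanish, since \<open>i < N\<close>.\<close>
  have 1: "(if Suc j < N then coarse_kernel \<mu> 0 i (Suc j) else 0) = coarse_kernel \<mu> 1 i j"
    using assms by (auto simp: coarse_kernel_def)
  have "coarse_kernel \<mu> 0 i j = (if i = j then 1 else 0) + \<mu> * coarse_kernel \<mu> 1 i j"
    by (subst coarse_kernel_rec) (auto simp: coarse_kernel_def)
  thus ?thesis unfolding sum_bidiag_right[OF assms(2)] 1 by (simp add: algebra_simps)
qed

text \<open>The same kernel as for the error, because \<open>S\<close> commutes with the inverse of
  \<open>B\<close>.\<close>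

lemma res_core:
  assumes "i < N" "j < N"
  shows "(if i = j then 1 else 0) - (\<Sum>l<N. bidiag c i l * coarse_kernel \<mu> 0 l j) = (c - \<mu>) * coarse_kernel \<mu> 1 i j"
proof -
  have 1: "(if i = 0 then 0 else coarse_kernel \<mu> 0 (i - 1) j) = coarse_kernel \<mu> 1 i j"
    by (auto simp: coarse_kernel_def)
  have "coarse_kernel \<mu> 0 i j = (if i = j then 1 else 0) + \<mu> * coarse_kernel \<mu> 1 i j"
    by (subst coarse_kernel_rec) (auto simp: coarse_kernel_def)
  thus ?thesis unfolding sum_bidiag_left[OF assms(1)] 1 by (simp add: algebra_simps)
qed

text \<open>Here \<open>I - A = c S\<close>, so FCF-relaxation contributes one more factor
  \<open>c\<close> and one more shift.\<close>

lemma core_FCF: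
  assumes "i < N" "j < N"
  shows "(\<Sum>l<N. \<kappa> * coarse_kernel \<mu> 1 i l * ((if l = j then 1 else 0) - bidiag c l j)) = \<kappa> * c * coarse_kernel \<mu> 2 i j"
proof -
  have "(\<Sum>l<N. \<kappa> * coarse_kernel \<mu> 1 i l * ((if l = j then 1 else 0) - bidiag c l j)) =
      (\<Sum>l<N. if l = Suc j then \<kappa> * c * coarse_kernel \<mu> 1 i l else 0)"
    by (intro sum.cong) (auto simp: bidiag_def)
  also have "\<dots> = \<kappa> * c * coarse_kernel \<mu> 2 i j"
    using assms by (auto simp: coarse_kernel_def)
  finally show ?thesis .
qed

section \<open>Block operators reduced to scalar kernels\<close>

locale mgrit = eigenbasis +
  fixes \<Phi> \<Psi> :: "complex mat" and lam mu :: "nat \<Rightarrow> complex"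
  assumes \<Phi>: "\<Phi> \<in> carrier_mat n n" and \<Psi>: "\<Psi> \<in> carrier_mat n n"
    and ev\<Phi>: "\<And>i. i < n \<Longrightarrow> eigenvector \<Phi> (col U i) (lam i)"
    and ev\<Psi>: "\<And>i. i < n \<Longrightarrow> eigenvector \<Psi> (col U i) (mu i)"
begin

lemma num_points: "num_points (Suc K) (Suc M) = M * K + Suc M"
  by (simp add: num_points_def)

lemma block_bidiag_eigen:
  "block_bidiag n p \<Phi> = eig_block p p (\<lambda>a. bidiag (lam a))" "block_bidiag n p \<Psi> = eig_block p p (\<lambda>a. bidiag (mu a))"
  by (intro block_bidiag_eig_block \<Phi> ev\<Phi>, assumption) (intro block_bidiag_eig_block \<Psi> ev\<Psi>)

lemma spacetime: "spacetime_mat n (Suc K) (Suc M) \<Phi> = eig_block (M * Suc K + 1) (M * Suc K + 1) (\<lambda>a. bidiag (lam a))"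
  unfolding spacetime_mat_def block_bidiag_eigen num_points_def by simp

lemma idx: "C_idx n (Suc K) = {r. r div n \<in> {t. Suc K dvd t}}" "F_idx n (Suc K) = {r. r div n \<in> {t. \<not> Suc K dvd t}}"
  by (auto simp: C_idx_def F_idx_def)

lemma A_blocks:
  shows "A_ff n (Suc K) (Suc M) \<Phi> = eig_block (M * K) (M * K) (\<lambda>a t s. bidiag (lam a) (ftime K t) (ftime K s))"
    and "A_fc n (Suc K) (Suc M) \<Phi> = eig_block (M * K) (Suc M) (\<lambda>a t j. bidiag (lam a) (ftime K t) (j * Suc K))"
    and "A_cf n (Suc K) (Suc M) \<Phi> = eig_block (Suc M) (M * K) (\<lambda>a j s. bidiag (lam a) (j * Suc K) (ftime K s))"
proof -
  have "A_ff n (Suc K) (Suc M) \<Phi> = eig_block (M * K) (M * K) (\<lambda>a t s. bidiag (lam a) (ftime K t) (ftime K s)) \<and>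
    A_fc n (Suc K) (Suc M) \<Phi> = eig_block (M * K) (Suc M) (\<lambda>a t j. bidiag (lam a) (ftime K t) (j * Suc K)) \<and>
    A_cf n (Suc K) (Suc M) \<Phi> = eig_block (Suc M) (M * K) (\<lambda>a j s. bidiag (lam a) (j * Suc K) (ftime K s))"
  proof (cases "K = 0")
    case False
    hence K: "K > 0" by simp
    note F = ftime_enum(1,2)[OF K] ftime_enum(3)[OF K, where M = M]
      and C = ctime_enum(1,2)[of K] ctime_enum(3)[where K = K and M = M]
    show ?thesis
      unfolding A_ff_def A_fc_def A_cf_def spacetime idx
      by (intro conjI eig_block_submatrix F C)
  next
    \<comment> \<open>For \<open>K = 0\<close> there are no F-points, hence no increasing
      enumeration of them; the blocks have no entries and agree by their dimensions.\<close>
    case True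
    have none: "{i. i < d \<and> i \<in> F_idx n (Suc 0)} = {}" for d
      by (auto simp: F_idx_def True)
    have "card {i. i < (M * Suc K + 1) * n \<and> i \<in> C_idx n (Suc K)} = Suc M * n"
      by (simp add: C_idx_def True)
    hence "card {i. i < dim_row (spacetime_mat n (Suc K) (Suc M) \<Phi>) \<and> i \<in> C_idx n (Suc K)} = Suc M * n"
      "card {i. i < dim_col (spacetime_mat n (Suc K) (Suc M) \<Phi>) \<and> i \<in> C_idx n (Suc K)} = Suc M * n"
      unfolding spacetime dim_eig_block by simp_all
    thus ?thesis unfolding A_ff_def A_fc_def A_cf_def
      by (intro conjI eq_matI) (auto simp: dim_submatrix none True)
  qed
  thus "A_ff n (Suc K) (Suc M) \<Phi> = eig_block (M * K) (M * K) (\<lambda>a t s. bidiag (lam a) (ftime K t) (ftime K s))"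
    "A_fc n (Suc K) (Suc M) \<Phi> = eig_block (M * K) (Suc M) (\<lambda>a t j. bidiag (lam a) (ftime K t) (j * Suc K))"
    "A_cf n (Suc K) (Suc M) \<Phi> = eig_block (Suc M) (M * K) (\<lambda>a j s. bidiag (lam a) (j * Suc K) (ftime K s))"
    by auto
qed

text \<open>The existence of an F-index excludes \<open>K = 0\<close>, so coarsening factor 1 needs
  no separate treatment below.\<close>

lemma K_pos: "t < M * K \<Longrightarrow> K > (0::nat)"
  by (cases K) auto

lemma inv_A_ff: "mat_inv (A_ff n (Suc K) (Suc M) \<Phi>) = eig_block (M * K) (M * K) (\<lambda>a. ff_inverse K (lam a))"
  unfolding A_blocks by (intro mat_inv_eig_block) (simp add: ff_inverse_inverse K_pos)

lemma interp_op_eig_block: "interp_op n (Suc K) (Suc M) \<Phi> = eig_block (M * K + Suc M) (Suc M)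
    (\<lambda>a t j. if t < M * K then (if t div K = j then lam a ^ (t mod K + 1) else 0)
      else if t - M * K = j then 1 else 0)"
  unfolding interp_op_def inv_A_ff unfolding A_blocks eig_block_mult eig_block_uminus eig_block_one[symmetric] eig_block_append_rows
  by (intro eig_block_cong if_cong refl, subst ff_inverse_fc[OF K_pos], assumption, assumption, rule minus_minus)

lemma restr_op_eig_block: "restr_op n (Suc K) (Suc M) \<Phi> = eig_block (Suc M) (M * K + Suc M)
    (\<lambda>a j t. if t < M * K then (if j = t div K + 1 then lam a ^ (K - t mod K) else 0)
      else if j = t - M * K then 1 else 0)"
  unfolding restr_op_def inv_A_ff unfolding A_blocks eig_block_mult eig_block_uminus eig_block_one[symmetric] eig_block_append_cols
  by (intro eig_block_cong if_cong refl, subst ff_inverse_cf[OF K_pos], assumption, simp, assumption, rule minus_minus)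

lemma num_F: "num_F n (Suc K) (Suc M) = (M * K) * n"
  by (simp add: num_F_def num_points_def)

lemma A_Delta_eig_block: "A_Delta n (Suc K) (Suc M) \<Phi> = eig_block (Suc M) (Suc M) (\<lambda>a. bidiag (lam a ^ Suc K))"
  unfolding A_Delta_def
proof (rule block_bidiag_eig_block)
  show "\<Phi> ^\<^sub>m Suc K \<in> carrier_mat n n" using \<Phi> by (rule pow_carrier_mat)
  fix i assume i: "i < n"
  have "eigenvector \<Phi> (col U i) (lam i)" using ev\<Phi>[OF i] .
  moreover from this have "\<Phi> ^\<^sub>m Suc K *\<^sub>v col U i = lam i ^ Suc K \<cdot>\<^sub>v col U i"
    by (rule eigenvector_pow[OF \<Phi>])
  moreover have "dim_row (\<Phi> ^\<^sub>m Suc K) = n" "dim_row \<Phi> = n"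
    using \<Phi> pow_carrier_mat[OF \<Phi>, of "Suc K"] by blast+
  ultimately show "eigenvector (\<Phi> ^\<^sub>m Suc K) (col U i) (lam i ^ Suc K)"
    by (auto simp only: eigenvector_def)
qed

lemma inv_B_Delta: "mat_inv (B_Delta n (Suc M) \<Psi>) = eig_block (Suc M) (Suc M) (\<lambda>a. coarse_kernel (mu a) 0)"
  unfolding B_Delta_def block_bidiag_eigen
  by (intro mat_inv_eig_block coarse_kernel_inverse)

text \<open>The scalar \<open>c - \<mu>\<close> of \<open>err_core\<close> with
  \<open>c = \<lambda>\<^sup>k\<close>; its modulus is the numerator of the rate.\<close>

definition \<kappa> :: "nat \<Rightarrow> nat \<Rightarrow> complex" where "\<kappa> K a = lam a ^ Suc K - mu a"

lemma cores:
  fixes K M :: nat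
  defines "A \<equiv> A_Delta n (Suc K) (Suc M) \<Phi>" and "B \<equiv> B_Delta n (Suc M) \<Psi>" and "I \<equiv> 1\<^sub>m (Suc M * n)"
  shows "I - mat_inv B * A = eig_block (Suc M) (Suc M) (\<lambda>a i j. \<kappa> K a * coarse_kernel (mu a) 1 i j)"
    and "I - A * mat_inv B = eig_block (Suc M) (Suc M) (\<lambda>a i j. \<kappa> K a * coarse_kernel (mu a) 1 i j)"
    and "(I - mat_inv B * A) * (I - A) = eig_block (Suc M) (Suc M) (\<lambda>a i j. \<kappa> K a * lam a ^ Suc K * coarse_kernel (mu a) 2 i j)"
    and "(I - A * mat_inv B) * (I - A) = eig_block (Suc M) (Suc M) (\<lambda>a i j. \<kappa> K a * lam a ^ Suc K * coarse_kernel (mu a) 2 i j)"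
proof -
  show 1: "I - mat_inv B * A = eig_block (Suc M) (Suc M) (\<lambda>a i j. \<kappa> K a * coarse_kernel (mu a) 1 i j)"
    unfolding A_def B_def I_def inv_B_Delta A_Delta_eig_block eig_block_mult eig_block_one[symmetric] eig_block_minus \<kappa>_def
    by (intro eig_block_cong err_core)
  show 2: "I - A * mat_inv B = eig_block (Suc M) (Suc M) (\<lambda>a i j. \<kappa> K a * coarse_kernel (mu a) 1 i j)"
    unfolding A_def B_def I_def inv_B_Delta A_Delta_eig_block eig_block_mult eig_block_one[symmetric] eig_block_minus \<kappa>_def
    by (intro eig_block_cong res_core)
  have 3: "eig_block (Suc M) (Suc M) (\<lambda>a i j. \<kappa> K a * coarse_kernel (mu a) 1 i j) * (I - A) =
      eig_block (Suc M) (Suc M) (\<lambda>a i j. \<kappa> K a * lam a ^ Suc K * coarse_kernel (mu a) 2 i j)"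
    unfolding A_def I_def A_Delta_eig_block eig_block_one[symmetric] eig_block_minus eig_block_mult
    by (intro eig_block_cong core_FCF)
  show "(I - mat_inv B * A) * (I - A) = eig_block (Suc M) (Suc M) (\<lambda>a i j. \<kappa> K a * lam a ^ Suc K * coarse_kernel (mu a) 2 i j)"
    unfolding 1 by (rule 3)
  show "(I - A * mat_inv B) * (I - A) = eig_block (Suc M) (Suc M) (\<lambda>a i j. \<kappa> K a * lam a ^ Suc K * coarse_kernel (mu a) 2 i j)"
    unfolding 2 by (rule 3)
qed

text \<open>The free factor \<open>c\<close> and shift order \<open>d\<close> let one computation
  serve both relaxations.\<close>

lemma err_eig_block:
  "interp_op n (Suc K) (Suc M) \<Phi> * (0\<^sub>m (Suc M * n) (num_F n (Suc K) (Suc M)) @\<^sub>c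
      eig_block (Suc M) (Suc M) (\<lambda>a i j. c a * coarse_kernel (mu a) d i j)) =
    eig_block (M * K + Suc M) (M * K + Suc M) (\<lambda>a t s. c a * err_kernel (Suc K) (Suc M) d (lam a) (mu a) t s)"
  unfolding interp_op_eig_block num_F eig_block_zero[symmetric] eig_block_append_cols eig_block_mult
proof (rule eig_block_cong)
  fix a t s assume "a < n" and t: "t < M * K + Suc M" and s: "s < M * K + Suc M"
  let ?y = "\<lambda>j. if s < M * K then 0 else c a * coarse_kernel (mu a) d j (s - M * K)"
  let ?m = "\<lambda>t j. if t < M * K then (if t div K = j then lam a ^ (t mod K + 1) else 0)
      else if t - M * K = j then 1 else 0"
  have "(\<Sum>j<Suc M. ?m t j * ?y j) = (if t < M * K then lam a ^ (t mod K + 1) * ?y (t div K) else ?y (t - M * K))"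
  proof (cases "t < M * K")
    case True
    hence "t div K < Suc M" by (simp add: less_mult_imp_div_less less_SucI)
    moreover have "(\<Sum>j<Suc M. ?m t j * ?y j) = (\<Sum>j<Suc M. if j = t div K then lam a ^ (t mod K + 1) * ?y j else 0)"
      using True by (intro sum.cong refl) auto
    ultimately show ?thesis using True by (simp del: sum.lessThan_Suc)
  next
    case False
    have "(\<Sum>j<Suc M. ?m t j * ?y j) = (\<Sum>j<Suc M. if j = t - M * K then ?y j else 0)"
      using False by (intro sum.cong refl) auto
    moreover have "t - M * K < Suc M" using False t by linarith
    ultimately show ?thesis using False by (simp del: sum.lessThan_Suc) 
  qed
  thus "(\<Sum>j<Suc M. ?m t j * ?y j) = c a * err_kernel (Suc K) (Suc M) d (lam a) (mu a) t s"
    by (simp add: err_kernel_def Let_def del: sum.lessThan_Suc)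
qed

lemma res_eig_block:
  "(0\<^sub>m (num_F n (Suc K) (Suc M)) (Suc M * n) @\<^sub>r
      eig_block (Suc M) (Suc M) (\<lambda>a i j. c a * coarse_kernel (mu a) d i j)) * restr_op n (Suc K) (Suc M) \<Phi> =
    eig_block (M * K + Suc M) (M * K + Suc M) (\<lambda>a t s. c a * res_kernel (Suc K) (Suc M) d (lam a) (mu a) t s)"
  unfolding restr_op_eig_block num_F eig_block_zero[symmetric] eig_block_append_rows eig_block_mult
proof (rule eig_block_cong)
  fix a t s assume "a < n" and t: "t < M * K + Suc M" and s: "s < M * K + Suc M"
  let ?y = "\<lambda>j. if t < M * K then 0 else c a * coarse_kernel (mu a) d (t - M * K) j"
  let ?m = "\<lambda>j s. if s < M * K then (if j = s div K + 1 then lam a ^ (K - s mod K) else 0)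
      else if j = s - M * K then 1 else 0"
  have "(\<Sum>j<Suc M. ?y j * ?m j s) = (if s < M * K then ?y (s div K + 1) * lam a ^ (K - s mod K) else ?y (s - M * K))"
  proof (cases "s < M * K")
    case True
    hence "s div K + 1 < Suc M" by (simp add: less_mult_imp_div_less)
    moreover have "(\<Sum>j<Suc M. ?y j * ?m j s) = (\<Sum>j<Suc M. if j = s div K + 1 then ?y j * lam a ^ (K - s mod K) else 0)"
      using True by (intro sum.cong refl) auto
    ultimately show ?thesis using True by (simp del: sum.lessThan_Suc)
  next
    case False
    have "(\<Sum>j<Suc M. ?y j * ?m j s) = (\<Sum>j<Suc M. if j = s - M * K then ?y j else 0)"
      using False by (intro sum.cong refl) auto
    moreover have "s - M * K < Suc M" using False s by linarith
    ultimately show ?thesis using False by (simp del: sum.lessThan_Suc)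
  qed
  thus "(\<Sum>j<Suc M. ?y j * ?m j s) = c a * res_kernel (Suc K) (Suc M) d (lam a) (mu a) t s"
    by (simp add: res_kernel_def Let_def del: sum.lessThan_Suc)
qed

definition prop_norm :: "nat \<Rightarrow> nat \<Rightarrow> nat \<Rightarrow> nat \<Rightarrow> real" where
  "prop_norm K M d a = arr_norm (M * K + Suc M) (M * K + Suc M) (err_kernel (Suc K) (Suc M) d (lam a) (mu a))"

lemma propagator_norms:
  "UU_opnorm (Suc K) (Suc M) U (err_F n (Suc K) (Suc M) \<Phi> \<Psi>) =
    (MAX a\<in>{..<n}. cmod (\<kappa> K a) * prop_norm K M 1 a)" (is ?EF)
  "UU_opnorm (Suc K) (Suc M) U (res_F n (Suc K) (Suc M) \<Phi> \<Psi>) =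
    (MAX a\<in>{..<n}. cmod (\<kappa> K a) * prop_norm K M 1 a)" (is ?RF)
  "UU_opnorm (Suc K) (Suc M) U (err_FCF n (Suc K) (Suc M) \<Phi> \<Psi>) =
    (MAX a\<in>{..<n}. cmod (\<kappa> K a * lam a ^ Suc K) * prop_norm K M 2 a)" (is ?EFCF)
  "UU_opnorm (Suc K) (Suc M) U (res_FCF n (Suc K) (Suc M) \<Phi> \<Psi>) =
    (MAX a\<in>{..<n}. cmod (\<kappa> K a * lam a ^ Suc K) * prop_norm K M 2 a)" (is ?RFCF)
proof -
  note UU = UU_opnorm_eig_block[of "Suc K" "Suc M", unfolded num_points]
  have R: "arr_norm (M * K + Suc M) (M * K + Suc M) (res_kernel (Suc K) (Suc M) d (lam a) (mu a)) = prop_norm K M d a" for d a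
    using arr_norm_res_kernel[of "Suc M" "Suc K" d "lam a" "mu a"] by (simp add: prop_norm_def)
  show ?EF unfolding err_F_def Let_def cores(1) err_eig_block UU arr_norm_scale prop_norm_def ..
  show ?RF unfolding res_F_def Let_def cores(2) res_eig_block UU arr_norm_scale R ..
  show ?EFCF unfolding err_FCF_def Let_def cores(3) err_eig_block UU arr_norm_scale prop_norm_def ..
  show ?RFCF unfolding res_FCF_def Let_def cores(4) res_eig_block UU arr_norm_scale R ..
qed

end

section \<open>Convergence rates with an exact error term\<close>

lemma sum_even_powers:
  fixes x :: real
  assumes "0 \<le> x" "x < 1"
  shows "(\<Sum>m<k. x ^ (2 * m)) = (1 - x ^ (2 * k)) / (1 - x\<^sup>2)"
proof -
  have "x\<^sup>2 \<noteq> 1" using assms power_less_one_iff[of x 2] by simp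
  thus ?thesis using sum_gp_strict[of "x\<^sup>2" k] by (simp add: power_mult)
qed

text \<open>The \<open>O(1/N\<^sub>c)\<close> term in the denominator, obtained by solving the claimed formula for it.\<close>

definition rate_defect :: "nat \<Rightarrow> nat \<Rightarrow> complex \<Rightarrow> complex \<Rightarrow> nat \<Rightarrow> real" where
  "rate_defect k d l \<mu> Nc = sqrt (\<Sum>m<k. (cmod l) ^ (2 * m)) /
      arr_norm ((Nc - 1) * (k - 1) + Nc) ((Nc - 1) * (k - 1) + Nc) (err_kernel k Nc d l \<mu>) - (1 - cmod \<mu>)"

text \<open>By choice of the defect, the denominator is the interpolation factor divided by the
  scalar norm, hence positive. The free \<open>w\<close> stands for the numerators of both
  relaxations.\<close>

lemma rate_defect:
  assumes k: "k \<ge> 1" and l: "cmod l < 1" and Nc: "Nc \<ge> d + 1"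
  shows "(1 - cmod \<mu>) + rate_defect k d l \<mu> Nc > 0"
    and "w * arr_norm ((Nc - 1) * (k - 1) + Nc) ((Nc - 1) * (k - 1) + Nc) (err_kernel k Nc d l \<mu>) =
      sqrt ((1 - cmod l ^ (2 * k)) / (1 - cmod l ^ 2)) * (w / ((1 - cmod \<mu>) + rate_defect k d l \<mu> Nc))"
proof -
  define c where "c = sqrt (\<Sum>m<k. (cmod l) ^ (2 * m))"
  define G where "G = arr_norm ((Nc - 1) * (k - 1) + Nc) ((Nc - 1) * (k - 1) + Nc) (err_kernel k Nc d l \<mu>)"
  have "(\<Sum>m<k. (cmod l) ^ (2 * m)) \<ge> 1"
    using member_le_sum[of 0 "{..<k}" "\<lambda>m. (cmod l) ^ (2 * m)"] k by simp
  hence c: "c > 0" by (simp add: c_def)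
  have G: "G > 0" unfolding G_def using Nc by (rule arr_norm_err_kernel_pos)
  have e: "(1 - cmod \<mu>) + rate_defect k d l \<mu> Nc = c / G"
    by (simp add: rate_defect_def c_def G_def)
  show "(1 - cmod \<mu>) + rate_defect k d l \<mu> Nc > 0" unfolding e using c G by simp
  have "w * G = c * (w / (c / G))" using c G by (simp add: field_simps)
  thus "w * G = sqrt ((1 - cmod l ^ (2 * k)) / (1 - cmod l ^ 2)) * (w / ((1 - cmod \<mu>) + rate_defect k d l \<mu> Nc))"
    unfolding e using sum_even_powers[OF norm_ge_zero l, of k] by (simp add: c_def)
qed

theorem corollary3:
  fixes n k :: nat
    and \<Phi> \<Psi> U :: "complex mat"
    and lam mu :: "nat \<Rightarrow> complex"
  assumes "n \<ge> 1" and "k \<ge> 1"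
    and "\<Phi> \<in> carrier_mat n n" and "\<Psi> \<in> carrier_mat n n"
    and "stable_mat \<Phi>" and "stable_mat \<Psi>"
    and "U \<in> carrier_mat n n" and "invertible_mat U"
    and "\<And>i. i < n \<Longrightarrow> eigenvector \<Phi> (col U i) (lam i)"
    and "\<And>i. i < n \<Longrightarrow> eigenvector \<Psi> (col U i) (mu i)"
  shows "(\<forall>Nc\<ge>1.
            UU_opnorm k Nc U (res_F n k Nc \<Phi> \<Psi>) = UU_opnorm k Nc U (err_F n k Nc \<Phi> \<Psi>) \<and>
            UU_opnorm k Nc U (res_FCF n k Nc \<Phi> \<Psi>) = UU_opnorm k Nc U (err_FCF n k Nc \<Phi> \<Psi>))
    \<and> (\<exists>e :: nat \<Rightarrow> nat \<Rightarrow> real.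
          (\<forall>i<n. (\<lambda>Nc. e i Nc) \<in> O(\<lambda>Nc. 1 / real Nc)) \<and>
          (\<forall>Nc\<ge>2. (\<forall>i<n. (1 - cmod (mu i)) + e i Nc > 0) \<and>
             UU_opnorm k Nc U (err_F n k Nc \<Phi> \<Psi>) =
               (MAX i\<in>{..<n}.
                  sqrt ((1 - cmod (lam i) ^ (2 * k)) / (1 - cmod (lam i) ^ 2)) *
                  (cmod (mu i - lam i ^ k) / ((1 - cmod (mu i)) + e i Nc)))))
    \<and> (\<exists>e :: nat \<Rightarrow> nat \<Rightarrow> real.
          (\<forall>i<n. (\<lambda>Nc. e i Nc) \<in> O(\<lambda>Nc. 1 / real Nc)) \<and>
          (\<forall>Nc\<ge>3. (\<forall>i<n. (1 - cmod (mu i)) + e i Nc > 0) \<and>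
             UU_opnorm k Nc U (err_FCF n k Nc \<Phi> \<Psi>) =
               (MAX i\<in>{..<n}.
                  sqrt ((1 - cmod (lam i) ^ (2 * k)) / (1 - cmod (lam i) ^ 2)) *
                  (cmod (lam i) ^ k * cmod (mu i - lam i ^ k) / ((1 - cmod (mu i)) + e i Nc)))))"
proof -
  from assms(8) obtain V where UV: "U * V = 1\<^sub>m (dim_row U)" and VU: "V * U = 1\<^sub>m (dim_row V)"
    by (auto simp: invertible_mat_def inverts_mat_def)
  \<comment> \<open>\<open>inverts_mat\<close> does not fix the shape of \<open>V\<close>; both
    dimensions are read off from the two identities.\<close>
  have "dim_col V = n" using arg_cong[OF UV, of dim_col] assms(7) by simp
  moreover have "dim_row V = n" using arg_cong[OF VU, of dim_col] assms(7) by simp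
  ultimately have V: "V \<in> carrier_mat n n" by (rule carrier_matI[rotated])
  interpret mgrit n U V \<Phi> \<Psi> lam mu
    using assms V UV VU by unfold_locales auto
  obtain K where k: "k = Suc K" using assms(2) by (cases k) auto
  define G where "G d i Nc = arr_norm ((Nc - 1) * (k - 1) + Nc) ((Nc - 1) * (k - 1) + Nc) (err_kernel k Nc d (lam i) (mu i))" for d i Nc
  have norms: "UU_opnorm k Nc U (res_F n k Nc \<Phi> \<Psi>) = UU_opnorm k Nc U (err_F n k Nc \<Phi> \<Psi>)"
    "UU_opnorm k Nc U (res_FCF n k Nc \<Phi> \<Psi>) = UU_opnorm k Nc U (err_FCF n k Nc \<Phi> \<Psi>)"
    "UU_opnorm k Nc U (err_F n k Nc \<Phi> \<Psi>) = (MAX i\<in>{..<n}. cmod (mu i - lam i ^ k) * G 1 i Nc)"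
    "UU_opnorm k Nc U (err_FCF n k Nc \<Phi> \<Psi>) = (MAX i\<in>{..<n}. cmod (lam i) ^ k * cmod (mu i - lam i ^ k) * G 2 i Nc)"
    if Nc1: "Nc \<ge> 1" for Nc
  proof -
    obtain M where M: "Nc = Suc M" using Nc1 by (cases Nc) auto
    have \<kappa>: "cmod (\<kappa> K i) = cmod (mu i - lam i ^ k)" for i
      unfolding \<kappa>_def k by (rule norm_minus_commute)
    have G: "prop_norm K M d i = G d i Nc" for d i
      unfolding prop_norm_def G_def k M by simp
    show "UU_opnorm k Nc U (res_F n k Nc \<Phi> \<Psi>) = UU_opnorm k Nc U (err_F n k Nc \<Phi> \<Psi>)"
      "UU_opnorm k Nc U (res_FCF n k Nc \<Phi> \<Psi>) = UU_opnorm k Nc U (err_FCF n k Nc \<Phi> \<Psi>)"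
      unfolding k M propagator_norms by (rule refl)+
    show "UU_opnorm k Nc U (err_F n k Nc \<Phi> \<Psi>) = (MAX i\<in>{..<n}. cmod (mu i - lam i ^ k) * G 1 i Nc)"
      unfolding \<kappa>[symmetric] G[symmetric] unfolding k M propagator_norms ..
    show "UU_opnorm k Nc U (err_FCF n k Nc \<Phi> \<Psi>) = (MAX i\<in>{..<n}. cmod (lam i) ^ k * cmod (mu i - lam i ^ k) * G 2 i Nc)"
      unfolding \<kappa>[symmetric] G[symmetric] unfolding k M propagator_norms norm_mult norm_power
      by (simp only: mult.commute)
  qed
  have lt: "cmod (lam i) < 1" "cmod (mu i) < 1" if "i < n" for i
    using cmod_eigenvalue_less_1[OF assms(3,5) assms(9)[OF that]]
      cmod_eigenvalue_less_1[OF assms(4,6) assms(10)[OF that]] by auto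
  have bigo: "(\<lambda>Nc. rate_defect k d (lam i) (mu i) Nc) \<in> O(\<lambda>Nc. 1 / real Nc)" if "i < n" for d i
    unfolding rate_defect_def by (rule arr_norm_err_kernel_asymp[OF assms(2) lt(2)[OF that]])
  have rate: "(1 - cmod (mu i)) + rate_defect k d (lam i) (mu i) Nc > 0"
    "w * G d i Nc = sqrt ((1 - cmod (lam i) ^ (2 * k)) / (1 - cmod (lam i) ^ 2)) *
      (w / ((1 - cmod (mu i)) + rate_defect k d (lam i) (mu i) Nc))"
    if "i < n" "Nc \<ge> d + 1" for i d Nc w
    unfolding G_def using rate_defect[OF assms(2) lt(1)[OF that(1)] that(2)] by blast+
  show ?thesis
  proof (intro conjI)
    show "\<forall>Nc\<ge>1.
        UU_opnorm k Nc U (res_F n k Nc \<Phi> \<Psi>) = UU_opnorm k Nc U (err_F n k Nc \<Phi> \<Psi>) \<and>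
        UU_opnorm k Nc U (res_FCF n k Nc \<Phi> \<Psi>) = UU_opnorm k Nc U (err_FCF n k Nc \<Phi> \<Psi>)"
      using norms(1,2) by blast
  next
    show "\<exists>e :: nat \<Rightarrow> nat \<Rightarrow> real.
          (\<forall>i<n. (\<lambda>Nc. e i Nc) \<in> O(\<lambda>Nc. 1 / real Nc)) \<and>
          (\<forall>Nc\<ge>2. (\<forall>i<n. (1 - cmod (mu i)) + e i Nc > 0) \<and>
             UU_opnorm k Nc U (err_F n k Nc \<Phi> \<Psi>) =
               (MAX i\<in>{..<n}.
                  sqrt ((1 - cmod (lam i) ^ (2 * k)) / (1 - cmod (lam i) ^ 2)) *
                  (cmod (mu i - lam i ^ k) / ((1 - cmod (mu i)) + e i Nc))))"
    proof (intro exI[of _ "\<lambda>i. rate_defect k 1 (lam i) (mu i)"] conjI allI impI bigo)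
      fix Nc :: nat assume Nc: "Nc \<ge> 2"
      hence Nc1: "Nc \<ge> 1" "Nc \<ge> 1 + 1" by auto
      show "(1 - cmod (mu i)) + rate_defect k 1 (lam i) (mu i) Nc > 0" if "i < n" for i
        by (rule rate(1)[OF that Nc1(2)])
      show "UU_opnorm k Nc U (err_F n k Nc \<Phi> \<Psi>) = (MAX i\<in>{..<n}.
          sqrt ((1 - cmod (lam i) ^ (2 * k)) / (1 - cmod (lam i) ^ 2)) *
          (cmod (mu i - lam i ^ k) / ((1 - cmod (mu i)) + rate_defect k 1 (lam i) (mu i) Nc)))"
        unfolding norms(3)[OF Nc1(1)]
        by (intro arg_cong[of _ _ Max] image_cong refl rate(2)[OF _ Nc1(2)]) simp
    qed
  next
    show "\<exists>e :: nat \<Rightarrow> nat \<Rightarrow> real.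
          (\<forall>i<n. (\<lambda>Nc. e i Nc) \<in> O(\<lambda>Nc. 1 / real Nc)) \<and>
          (\<forall>Nc\<ge>3. (\<forall>i<n. (1 - cmod (mu i)) + e i Nc > 0) \<and>
             UU_opnorm k Nc U (err_FCF n k Nc \<Phi> \<Psi>) =
               (MAX i\<in>{..<n}.
                  sqrt ((1 - cmod (lam i) ^ (2 * k)) / (1 - cmod (lam i) ^ 2)) *
                  (cmod (lam i) ^ k * cmod (mu i - lam i ^ k) / ((1 - cmod (mu i)) + e i Nc))))"
    proof (intro exI[of _ "\<lambda>i. rate_defect k 2 (lam i) (mu i)"] conjI allI impI bigo)
      fix Nc :: nat assume Nc: "Nc \<ge> 3"
      \<comment> \<open>FCF-relaxation shifts twice, so \<open>d = 2\<close> and positivity of the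
        norm takes three coarse points.\<close>
      hence Nc1: "Nc \<ge> 1" "Nc \<ge> 2 + 1" by auto
      show "(1 - cmod (mu i)) + rate_defect k 2 (lam i) (mu i) Nc > 0" if "i < n" for i
        by (rule rate(1)[OF that Nc1(2)])
      show "UU_opnorm k Nc U (err_FCF n k Nc \<Phi> \<Psi>) = (MAX i\<in>{..<n}.
          sqrt ((1 - cmod (lam i) ^ (2 * k)) / (1 - cmod (lam i) ^ 2)) *
          (cmod (lam i) ^ k * cmod (mu i - lam i ^ k) / ((1 - cmod (mu i)) + rate_defect k 2 (lam i) (mu i) Nc)))"
        unfolding norms(4)[OF Nc1(1)]
        by (intro arg_cong[of _ _ Max] image_cong refl rate(2)[OF _ Nc1(2)]) simp
    qed
  qed
qed

end
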